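(* For every $\varepsilon>0$, $$d_{KS}(Y_n,Y)=O\big(n^{\varepsilon-1/2}\big)\qquad\text{as }n\to\infty.$$
   Context: Let $X_n$ be the number of comparisons used by randomized Quicksort (uniform random pivot) on $n$ distinct numbers. Equivalently, $X_0=0$ and $$X_n\stackrel{d}{=}X_{U_n-1}+X^*_{n-U_n}+n-1,$$ with $U_n$ uniform on $\{1,\dots,n\}$, $X_j^*\stackrel{d}{=}X_j$, all independent. Let $\mu_n=\mathbf EX_n=2(n+1)H_n-4n$, where $H_n=\sum_{k\le n}1/k$, and $Y_n=(X_n-\mu_n)/n$. $Y$ is the distributional limit of $Y_n$. Its law is the unique law with mean $0$ and finite variance satisfying $Y\stackrel{d}{=}UY+(1-U)Y^*+C(U)$, where $U\sim\mathrm{unif}(0,1)$, $Y^*\stackrel{d}{=}Y$, $U,Y,Y^*$ are independent, and $C(u)=2u\ln u+2(1-u)\ln(1-u)+1$. It is known that $Y$ has a bounded density. $d_{KS}(X,Y):=\sup_x|P(X\le x)-P(Y\le x)|$. *)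

theory Defs
  imports "HOL-Probability.Probability" "HOL-Library.Landau_Symbols"
begin

fun qs_comparisons :: "nat \<Rightarrow> nat pmf" where
  "qs_comparisons 0 = return_pmf 0"
| "qs_comparisons (Suc n) =
     bind_pmf (pmf_of_set {1..Suc n}) (\<lambda>u.
     bind_pmf (qs_comparisons (u - 1)) (\<lambda>a.
     bind_pmf (qs_comparisons (Suc n - u)) (\<lambda>b.
     return_pmf (a + b + n))))"

definition qs_mean :: "nat \<Rightarrow> real" where
  "qs_mean n = 2 * (real n + 1) * harm n - 4 * real n"

definition Yn_law :: "nat \<Rightarrow> real measure" where
  "Yn_law n = measure_pmf (map_pmf (\<lambda>k. (real k - qs_mean n) / real n) (qs_comparisons n))"

definition toll :: "real \<Rightarrow> real" where
  "toll u = 2 * u * ln u + 2 * (1 - u) * ln (1 - u) + 1"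

definition is_quicksort_limit_law :: "real measure \<Rightarrow> bool" where
  "is_quicksort_limit_law M \<longleftrightarrow>
     prob_space M \<and> sets M = sets borel \<and>
     integrable M (\<lambda>x. x) \<and> integral\<^sup>L M (\<lambda>x. x) = 0 \<and>
     integrable M (\<lambda>x. x\<^sup>2) \<and>
     distr (uniform_measure lborel {0<..<1::real} \<Otimes>\<^sub>M (M \<Otimes>\<^sub>M M)) borel
       (\<lambda>(u, y, y'). u * y + (1 - u) * y' + toll u) = M"

definition d_KS :: "real measure \<Rightarrow> real measure \<Rightarrow> real" where
  "d_KS M N = (SUP x. \<bar>measure M {..x} - measure N {..x}\<bar>)"

end

theory Submission
  imports Defs "HOL-Real_Asymp.Real_Asymp"
begin

text \<open>
  The pair \<open>(X\<^sub>n, Y)\<close> is coupled recursively: draw the split \<open>k\<close> uniformly from \<open>{0..n}\<close> and \<open>v\<close>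
  uniformly from \<open>(0,1)\<close>, use \<open>u = (k + v) / (n + 1)\<close> in the equation for \<open>Y\<close>, and take the two
  subproblems from independent copies of the couplings of sizes \<open>k\<close> and \<open>n - k\<close>. The error
  \<open>X\<^sub>n - \<mu>\<^sub>n - n Y\<close> is then the sum of two independent centered errors and a small noise, and its
  absolute moments of order \<open>2, 4, 8, \<dots>\<close> satisfy divide-and-conquer recursions with solution
  \<open>O(n\<^bsup>\<alpha>q\<^esup>)\<close> for every \<open>\<alpha> > 1/2\<close>.

  A bounded density is not needed: \<open>P(Y \<in> [x - h, x + h]) = O(h\<^bsup>1-e\<^esup>)\<close> for every \<open>e > 0\<close>
  suffices. Gaussian smoothing reduces this to averages of the characteristic function \<open>\<phi>\<close>. Since
  \<open>toll'' \<ge> 4\<close>, the increments of \<open>u \<mapsto> u y + (1 - u) z + toll u\<close> are expanding uniformly in \<open>y\<close> and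
  \<open>z\<close>, which bounds the averages of \<open>\<bar>\<phi>\<bar>\<^sup>2\<close>; the bound passes to \<open>\<bar>\<phi>\<bar>\<close> because
  \<open>\<bar>\<phi> t\<bar> \<le> \<integral> \<bar>\<phi> (u t)\<bar> \<bar>\<phi> ((1 - u) t)\<bar> du\<close>. Markov's inequality at the scale \<open>h = n\<^bsup>2\<eta>-1/2\<^esup>\<close> combines
  the two estimates.
\<close>

section \<open>Gaussian smoothing of characteristic functions\<close>

lemma Fubini_bounded:
  fixes f :: "'a \<Rightarrow> 'b \<Rightarrow> complex"
  assumes P: "prob_space P" and Q: "prob_space Q"
    and [measurable]: "case_prod f \<in> borel_measurable (P \<Otimes>\<^sub>M Q)"
    and B: "\<And>x y. cmod (f x y) \<le> B"
  shows "(\<integral>y. \<integral>x. f x y \<partial>P \<partial>Q) = (\<integral>x. \<integral>y. f x y \<partial>Q \<partial>P)"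
proof -
  interpret P: prob_space P by fact
  interpret Q: prob_space Q by fact
  interpret PQ: pair_prob_space P Q ..
  have "integrable (P \<Otimes>\<^sub>M Q) (case_prod f)"
    using B by (intro PQ.integrable_const_bound[where B=B]) (auto simp: split_beta')
  then show ?thesis
    by (rule PQ.Fubini_integral)
qed

text \<open>The Gaussian kernel is a characteristic function: exp(-(T (y - x))^2 / 2) is the mean of
  \<open>iexp (T * (y - x) * t)\<close> over a standard normal t. Exchanging the integrals over y
  and t leaves \<open>char P (t * T)\<close>.\<close>

lemma char_gaussian_smoothing:
  assumes "real_distribution P"
  shows "complex_of_real (\<integral>y. exp (- (T * (y - x))\<^sup>2 / 2) \<partial>P)
       = (\<integral>t. iexp (- (t * T * x)) * char P (t * T) \<partial>std_normal_distribution)"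
proof -
  interpret P: real_distribution P by fact
  interpret N: real_distribution std_normal_distribution by (rule real_dist_normal_dist)
  have "(\<integral>t. iexp (- (t * T * x)) * char P (t * T) \<partial>std_normal_distribution)
      = (\<integral>t. \<integral>y. iexp (T * (y - x) * t) \<partial>P \<partial>std_normal_distribution)"
    unfolding char_def
    by (intro Bochner_Integration.integral_cong refl, subst integral_mult_right_zero[symmetric],
        intro Bochner_Integration.integral_cong refl)
       (simp add: exp_add[symmetric] algebra_simps)
  also have "\<dots> = (\<integral>y. \<integral>t. iexp (T * (y - x) * t) \<partial>std_normal_distribution \<partial>P)"
    by (rule Fubini_bounded[where B=1]) (auto intro: P.prob_space_axioms N.prob_space_axioms)
  also have "\<dots> = (\<integral>y. char std_normal_distribution (T * (y - x)) \<partial>P)"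
    unfolding char_def ..
  also have "\<dots> = (\<integral>y. complex_of_real (exp (- (T * (y - x))\<^sup>2 / 2)) \<partial>P)"
    by (simp add: char_std_normal_distribution)
  finally show ?thesis by simp
qed

text \<open>Averaging \<open>char_gaussian_smoothing\<close> over x drawn from P turns the factor
  \<open>iexp (- (t * T * x))\<close> into the conjugate of \<open>char P (t * T)\<close>. The mean
  square of the characteristic function thus measures how often two independent draws from P come
  within about 1/T of each other.\<close>

lemma char_sq_gaussian_smoothing:
  assumes "real_distribution P"
  shows "(\<integral>t. (cmod (char P (t * T)))\<^sup>2 \<partial>std_normal_distribution)
       = (\<integral>x. \<integral>y. exp (- (T * (y - x))\<^sup>2 / 2) \<partial>P \<partial>P)"
proof -
  interpret P: real_distribution P by fact
  interpret N: real_distribution std_normal_distribution by (rule real_dist_normal_dist)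
  have "complex_of_real (\<integral>x. \<integral>y. exp (- (T * (y - x))\<^sup>2 / 2) \<partial>P \<partial>P)
      = (\<integral>x. \<integral>t. iexp (- (t * T * x)) * char P (t * T) \<partial>std_normal_distribution \<partial>P)"
    by (subst integral_complex_of_real[symmetric],
        intro Bochner_Integration.integral_cong refl char_gaussian_smoothing assms)
  also have "\<dots> = (\<integral>t. \<integral>x. iexp (- (t * T * x)) * char P (t * T) \<partial>P \<partial>std_normal_distribution)"
    by (rule Fubini_bounded[where B=1])
       (auto intro: P.prob_space_axioms N.prob_space_axioms simp: norm_mult P.cmod_char_le_1)
  also have "\<dots> = (\<integral>t. complex_of_real ((cmod (char P (t * T)))\<^sup>2) \<partial>std_normal_distribution)"
  proof (intro Bochner_Integration.integral_cong refl)
    fix t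
    have "(\<integral>x. iexp (- (t * T * x)) \<partial>P) = cnj (char P (t * T))"
      unfolding char_def by (subst Bochner_Integration.integral_cnj[symmetric]) (simp add: exp_cnj)
    then show "(\<integral>x. iexp (- (t * T * x)) * char P (t * T) \<partial>P) = complex_of_real ((cmod (char P (t * T)))\<^sup>2)"
      unfolding complex_norm_square by simp
  qed
  finally show ?thesis
    by (metis integral_complex_of_real of_real_eq_iff)
qed

text \<open>On the interval of radius h the Gaussian kernel of width h is at least exp(-1/2), so
  exp(1/2) times the kernel dominates the indicator; smoothing with T = 1/h and the triangle
  inequality do the rest.\<close>

lemma concentration_le_char:
  assumes "real_distribution P" and "h > 0"
  shows "measure P {x - h..x + h} \<le> exp (1/2) * (\<integral>t. cmod (char P (t * (1 / h))) \<partial>std_normal_distribution)"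
proof -
  interpret P: real_distribution P by fact
  interpret N: real_distribution std_normal_distribution by (rule real_dist_normal_dist)
  have int: "integrable P (\<lambda>y. exp (- (1 / h * (y - x))\<^sup>2 / 2))"
    by (intro P.integrable_const_bound[where B=1]) auto
  have "measure P {x - h..x + h} = (\<integral>y. indicator {x - h..x + h} y \<partial>P)"
    by simp
  also have "\<dots> \<le> (\<integral>y. exp (1/2) * exp (- (1 / h * (y - x))\<^sup>2 / 2) \<partial>P)"
  proof (rule integral_mono)
    show "integrable P (\<lambda>y. exp (1/2) * exp (- (1 / h * (y - x))\<^sup>2 / 2))" using int by simp
    fix y
    show "indicator {x - h..x + h} y \<le> exp (1/2) * exp (- (1 / h * (y - x))\<^sup>2 / 2)"
    proof (cases "y \<in> {x - h..x + h}")
      case True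
      then have "\<bar>1 / h * (y - x)\<bar> \<le> 1" using \<open>h > 0\<close> by (auto simp: abs_if field_simps)
      then have "(1 / h * (y - x))\<^sup>2 \<le> 1" by (simp add: abs_square_le_1)
      then have "1 \<le> exp (1/2 + (- (1 / h * (y - x))\<^sup>2 / 2))" by simp
      then have "1 \<le> exp (1/2) * exp (- (1 / h * (y - x))\<^sup>2 / 2)" by (simp only: exp_add)
      then show ?thesis using True by simp
    qed simp
  qed (auto simp: P.emeasure_eq_measure)
  also have "\<dots> = exp (1/2) * (\<integral>y. exp (- (1 / h * (y - x))\<^sup>2 / 2) \<partial>P)" by simp
  also have "(\<integral>y. exp (- (1 / h * (y - x))\<^sup>2 / 2) \<partial>P) \<le> (\<integral>t. cmod (char P (t * (1 / h))) \<partial>std_normal_distribution)"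
  proof -
    have "(\<integral>y. exp (- (1 / h * (y - x))\<^sup>2 / 2) \<partial>P) \<le> cmod (complex_of_real (\<integral>y. exp (- (1 / h * (y - x))\<^sup>2 / 2) \<partial>P))"
      by simp
    also have "\<dots> \<le> (\<integral>t. cmod (iexp (- (t * (1/h) * x)) * char P (t * (1/h))) \<partial>std_normal_distribution)"
      unfolding char_gaussian_smoothing[OF assms(1)] by (rule integral_norm_bound)
    finally show ?thesis by (simp add: norm_mult)
  qed
  finally show ?thesis by simp
qed

section \<open>Strong convexity of the toll function\<close>

abbreviation unif01 :: "real measure" where
  "unif01 \<equiv> uniform_measure lborel {0<..<1}"

lemma prob_space_unif01: "prob_space unif01"
  by (rule prob_space_uniform_measure) auto

lemma nn_integral_unif01:
  "f \<in> borel_measurable borel \<Longrightarrow>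
    (\<integral>\<^sup>+u. f u \<partial>unif01) = (\<integral>\<^sup>+u. f u * indicator {0<..<1} u \<partial>lborel)"
  by (subst nn_integral_uniform_measure) (auto simp: divide_ennreal_def)

lemma AE_unif01: "AE u in unif01. 0 < u \<and> u < 1"
  using AE_uniform_measureI[of "{0<..<1::real}" lborel "\<lambda>u. 0 < u \<and> u < 1"] by auto

lemma toll_measurable [measurable]: "toll \<in> borel_measurable borel"
  unfolding toll_def[abs_def] by measurable

text \<open>Subtracting 2 x^2, whose increments account for the left-hand side, leaves F with F'' =
  2/x + 2/(1 - x) - 4 >= 0. So F' is nondecreasing, and the increment of F over a fixed step s grows
  with the starting point.\<close>

lemma toll_strongly_convex:
  assumes "0 < u" "u \<le> v" "0 \<le> s" "v + s < 1"
  shows "4 * s * (v - u) \<le> (toll (v + s) - toll v) - (toll (u + s) - toll u)"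
proof -
  define F where "F x = toll x - 2 * x\<^sup>2" for x
  define F' where "F' x = 2 * ln x - 2 * ln (1 - x) - 4 * x" for x :: real
  have dF: "(F has_real_derivative F' x) (at x)" if "0 < x" "x < 1" for x
  proof -
    have "(F has_real_derivative (2 * ln x + 2 * (x * (1 / x)))
        + (- 2 * ln (1 - x) - 2 * ((1 - x) * (1 / (1 - x)))) - 4 * x) (at x)"
      unfolding F_def toll_def using that
      by (auto intro!: derivative_eq_intros) (simp add: field_simps)
    moreover have e: "x * (1 / x) = 1" "(1 - x) * (1 / (1 - x)) = 1" using that by auto
    ultimately show ?thesis unfolding e F'_def by (simp add: algebra_simps)
  qed
  have dF': "(F' has_real_derivative 2 / x + 2 / (1 - x) - 4) (at x)" if "0 < x" "x < 1" for x
    unfolding F'_def using that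
    by (auto intro!: derivative_eq_intros simp: field_simps)
  have mono: "F' x \<le> F' y" if "0 < x" "x \<le> y" "y < 1" for x y
  proof (rule DERIV_nonneg_imp_nondecreasing[OF \<open>x \<le> y\<close>])
    fix z assume "x \<le> z" "z \<le> y"
    with that have z: "0 < z" "z < 1" by auto
    then have "2 / z \<ge> 2" "2 / (1 - z) \<ge> 2" by (auto simp: field_simps)
    then show "\<exists>d. (F' has_real_derivative d) (at z) \<and> 0 \<le> d"
      using dF'[OF z] by (intro exI[of _ "2 / z + 2 / (1 - z) - 4"]) simp
  qed
  have "F (u + s) - F u \<le> F (v + s) - F v"
  proof (rule DERIV_nonneg_imp_nondecreasing[OF \<open>u \<le> v\<close>, of "\<lambda>x. F (x + s) - F x"])
    fix z assume z: "u \<le> z" "z \<le> v"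
    have "((\<lambda>x. F (x + s) - F x) has_real_derivative F' (z + s) - F' z) (at z)"
      using assms z by (intro derivative_intros DERIV_shift[THEN iffD1] dF) auto
    moreover have "F' z \<le> F' (z + s)" using assms z by (intro mono) auto
    ultimately show "\<exists>d. ((\<lambda>x. F (x + s) - F x) has_real_derivative d) (at z) \<and> 0 \<le> d" by auto
  qed
  then show ?thesis unfolding F_def by (simp add: power2_eq_square algebra_simps)
qed

definition mix :: "real \<Rightarrow> real \<Rightarrow> real \<Rightarrow> real" where
  "mix y z u = u * y + (1 - u) * z + toll u"

lemma mix_measurable [measurable (raw)]:
  assumes [measurable]: "f \<in> borel_measurable M" "g \<in> borel_measurable M" "h \<in> borel_measurable M"
  shows "(\<lambda>x. mix (f x) (g x) (h x)) \<in> borel_measurable M"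
  unfolding mix_def by measurable

text \<open>The affine part of \<open>mix\<close> contributes the constant s (y - z) to the
  increment, so y and z drop out of \<open>g u - g v\<close> and only the convexity of
  \<open>toll\<close> counts.\<close>

lemma mix_increment_expanding:
  fixes y z s :: real
  defines "g \<equiv> \<lambda>u. mix y z (u + s) - mix y z u"
  assumes "{u, v, u + s, v + s} \<subseteq> {0<..<1}"
  shows "4 * \<bar>s\<bar> * \<bar>u - v\<bar> \<le> \<bar>g u - g v\<bar>"
  using assms(2)
proof (induction u v rule: linorder_wlog)
  case (sym a b)
  then show ?case by (simp add: abs_minus_commute insert_commute)
next
  case (le u v)
  show ?case
  proof (cases "s \<ge> 0")
    case True
    have "4 * s * (v - u) \<le> g v - g u"
      using toll_strongly_convex[of u v s] le True by (simp add: g_def mix_def algebra_simps)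
    then show ?thesis using le True by (simp add: abs_if)
  next
    case False
    \<comment> \<open>A negative step from u is the positive step -s from u + s read backwards,
      which reverses the sign of g.\<close>
    have "4 * (-s) * ((v + s) - (u + s)) \<le> g u - g v"
      using toll_strongly_convex[of "u + s" "v + s" "-s"] le False by (simp add: g_def mix_def algebra_simps)
    then show ?thesis using le False by (simp add: abs_if)
  qed
qed

section \<open>Gaussian integrals along expanding functions\<close>

lemma nn_integral_normal_density:
  "\<sigma> > 0 \<Longrightarrow> (\<integral>\<^sup>+x. ennreal (normal_density \<mu> \<sigma> x) \<partial>lborel) = 1"
  using prob_space.emeasure_space_1[OF prob_space_normal_density, of \<sigma> \<mu>]
  by (simp add: emeasure_density)

text \<open>An expanding g is small only near one point: if w nearly minimizes |g|, then |g u| grows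
  at least linearly in c |u - w|, and exp(-g^2/2) lies below a multiple of a normal density centered
  at w with deviation of order 1/c.\<close>

lemma expanding_gaussian_integral:
  fixes g :: "real \<Rightarrow> real"
  assumes [measurable]: "S \<in> sets borel" and "c > 0"
    and exp: "\<And>u v. u \<in> S \<Longrightarrow> v \<in> S \<Longrightarrow> c * \<bar>u - v\<bar> \<le> \<bar>g u - g v\<bar>"
  shows "(\<integral>\<^sup>+u. ennreal (exp (- (g u)\<^sup>2 / 2)) * indicator S u \<partial>lborel) \<le> ennreal (16 / c)"
proof (cases "S = {}")
  case False
  then obtain w0 where "w0 \<in> S" by auto
  \<comment> \<open>\<open>w\<close> minimizes \<open>\<bar>g\<bar>\<close> up to an error of 1; rounding down to \<open>nat\<close> makes a minimizer exist.\<close>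
  then obtain w where w: "w \<in> S" "\<And>u. u \<in> S \<Longrightarrow> nat \<lfloor>\<bar>g w\<bar>\<rfloor> \<le> nat \<lfloor>\<bar>g u\<bar>\<rfloor>"
    using ex_has_least_nat[of "\<lambda>u. u \<in> S" w0 "\<lambda>u. nat \<lfloor>\<bar>g u\<bar>\<rfloor>"] by auto
  have near: "\<bar>g w\<bar> \<le> \<bar>g u\<bar> + 1" if "u \<in> S" for u
    using w(2)[OF that] by linarith
  \<comment> \<open>With this \<sigma> the exponent (u - w)^2 / (2 \<sigma>^2) is c^2 (u - w)^2 /
    16, the one obtained below.\<close>
  define \<sigma> where "\<sigma> = sqrt 8 / c"
  have \<sigma>: "\<sigma> > 0" "\<sigma>\<^sup>2 = 8 / c\<^sup>2" using \<open>c > 0\<close> by (auto simp: \<sigma>_def power_divide)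
  \<comment> \<open>The constant 16 is 2, bounding exp(1/2), times 8, from the normalization sqrt (2
    pi \<sigma>^2) <= 8/c.\<close>
  have bound: "exp (- (g u)\<^sup>2 / 2) \<le> 16 / c * normal_density w \<sigma> u" if "u \<in> S" for u
  proof -
    have "c * \<bar>u - w\<bar> \<le> 2 * \<bar>g u\<bar> + 1" using exp[OF that w(1)] near[OF that] by linarith
    then have "(c * \<bar>u - w\<bar>)\<^sup>2 \<le> (2 * \<bar>g u\<bar> + 1)\<^sup>2" using \<open>c > 0\<close> by (intro power_mono) auto
    also have "\<dots> \<le> 8 * (g u)\<^sup>2 + 2"
      using zero_le_power2[of "2 * \<bar>g u\<bar> - 1"] by (simp add: power2_eq_square algebra_simps)
    finally have "c\<^sup>2 * (u - w)\<^sup>2 \<le> 8 * (g u)\<^sup>2 + 2" by (simp add: power_mult_distrib)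
    then have "- (g u)\<^sup>2 / 2 \<le> 1/2 + - (c\<^sup>2 * (u - w)\<^sup>2) / 16"
      by (simp add: field_simps)
    then have "exp (- (g u)\<^sup>2 / 2) \<le> exp (1/2) * exp (- (c\<^sup>2 * (u - w)\<^sup>2) / 16)"
      by (metis exp_add exp_le_cancel_iff)
    also have "\<dots> \<le> 2 * exp (- (c\<^sup>2 * (u - w)\<^sup>2) / 16)"
      by (intro mult_right_mono exp_bound_half[of "1/2::real", simplified]) auto
    also have "exp (- (c\<^sup>2 * (u - w)\<^sup>2) / 16) = sqrt (2 * pi * \<sigma>\<^sup>2) * normal_density w \<sigma> u"
      unfolding normal_density_def \<sigma> using \<open>c > 0\<close> by (simp add: field_simps)
    also have "sqrt (2 * pi * \<sigma>\<^sup>2) \<le> 8 / c"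
    proof (rule real_le_lsqrt)
      show "2 * pi * \<sigma>\<^sup>2 \<le> (8 / c)\<^sup>2" unfolding \<sigma> power_divide using pi_less_4 \<open>c > 0\<close>
        by (simp add: field_simps)
    qed (use \<open>c > 0\<close> in auto)
    finally show ?thesis by (simp add: mult_right_mono)
  qed
  have "(\<integral>\<^sup>+u. ennreal (exp (- (g u)\<^sup>2 / 2)) * indicator S u \<partial>lborel)
      \<le> (\<integral>\<^sup>+u. ennreal (16 / c) * ennreal (normal_density w \<sigma> u) \<partial>lborel)"
    using bound \<open>c > 0\<close>
    by (intro nn_integral_mono) (auto simp: ennreal_mult'[symmetric] split: split_indicator intro!: ennreal_leI)
  also have "\<dots> = ennreal (16 / c)"
    using \<sigma> by (subst nn_integral_cmult) (auto simp: nn_integral_normal_density)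
  finally show ?thesis .
qed simp

lemma nn_integral_powr_01:
  assumes "0 < e"
  shows "(\<integral>\<^sup>+s. ennreal (s powr (e - 1)) * indicator {0..1} s \<partial>lborel) = ennreal (1 / e)"
  using nn_integral_has_integral_lebesgue[OF _ has_integral_powr_from_0[of "e - 1" 1]] assms
  by (simp add: ennreal_mult' ennreal_indicator mult.commute nn_integral_completion)

lemma nn_integral_abs_powr:
  assumes "0 < e"
  shows "(\<integral>\<^sup>+s. ennreal (\<bar>s\<bar> powr (e - 1)) * indicator {-1<..<1} s \<partial>lborel) \<le> ennreal (2 / e)"
proof -
  let ?f = "\<lambda>s::real. ennreal (s powr (e - 1)) * indicator {0..1} s"
  have [measurable]: "?f \<in> borel_measurable borel" by measurable
  have "(\<integral>\<^sup>+s. ennreal (\<bar>s\<bar> powr (e - 1)) * indicator {-1<..<1} s \<partial>lborel)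
      \<le> (\<integral>\<^sup>+s. ?f s + ?f (0 + (-1) * s) \<partial>lborel)"
    by (intro nn_integral_mono) (auto split: split_indicator)
  also have "\<dots> = (\<integral>\<^sup>+s. ?f s \<partial>lborel) + (\<integral>\<^sup>+s. ?f (0 + (-1) * s) \<partial>lborel)"
    by (rule nn_integral_add) auto
  also have "(\<integral>\<^sup>+s. ?f (0 + (-1) * s) \<partial>lborel) = (\<integral>\<^sup>+s. ?f s \<partial>lborel)"
    by (subst (2) nn_integral_real_affine[where c="-1" and t=0]) auto
  also have "(\<integral>\<^sup>+s. ?f s \<partial>lborel) + (\<integral>\<^sup>+s. ?f s \<partial>lborel) = ennreal (2 / e)"
    unfolding nn_integral_powr_01[OF assms] using assms by (simp flip: ennreal_plus)
  finally show ?thesis .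
qed

text \<open>Interpolation between the bounds 1 and b. It turns a bound of order 1/|s|, not
  integrable at 0, into the integrable |s|^(e-1).\<close>

lemma min_one_le_powr:
  fixes a :: real
  assumes "a \<le> 1" "a \<le> b" "0 < b" "0 \<le> r" "r \<le> 1"
  shows "a \<le> b powr r"
proof (cases "b \<le> 1")
  case True
  then have "b powr 1 \<le> b powr r" using assms by (intro powr_mono') auto
  then show ?thesis using assms by simp
next
  case False
  then have "1 \<le> b powr r" using assms by (intro ge_one_powr_ge_zero) auto
  then show ?thesis using assms by simp
qed

text \<open>Write v = u + s and integrate over u first. For fixed s the increment of
  \<open>mix\<close> expands by 4 |s|, so the u-integral is at most 4 / (T |s|) as well as at most
  1; interpolating gives a multiple of (T |s|)^(e-1), which is integrable in s.\<close>

lemma nn_integral_mix_gaussian: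
  assumes "T > 0" "0 < e" "e < 1"
  shows "(\<integral>\<^sup>+u. \<integral>\<^sup>+v. ennreal (exp (- (T * (mix y z v - mix y z u))\<^sup>2 / 2)) \<partial>unif01 \<partial>unif01)
      \<le> ennreal (32 / e * T powr (e - 1))"
proof -
  let ?E = "\<lambda>u v. ennreal (exp (- (T * (mix y z v - mix y z u))\<^sup>2 / 2))"
  let ?I = "\<lambda>u. indicator {0<..<1::real} u :: ennreal"
  have slice: "(\<integral>\<^sup>+u. ?E u (u + s) * ?I (u + s) * ?I u \<partial>lborel)
      \<le> ennreal (16 * T powr (e - 1)) * (ennreal (\<bar>s\<bar> powr (e - 1)) * indicator {-1<..<1} s)" if "s \<noteq> 0" for s
  proof (cases "\<bar>s\<bar> < 1")
    case True
    define S where "S = {u. u \<in> {0<..<1} \<and> u + s \<in> {0<..<1}}"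
    have S[measurable]: "S \<in> sets borel" unfolding S_def by measurable
    let ?J = "\<integral>\<^sup>+u. ennreal (exp (- (T * (mix y z (u + s) - mix y z u))\<^sup>2 / 2)) * indicator S u \<partial>lborel"
    have eq: "(\<integral>\<^sup>+u. ?E u (u + s) * ?I (u + s) * ?I u \<partial>lborel) = ?J"
      by (intro nn_integral_cong) (auto simp: S_def split: split_indicator)
    have "?J \<le> (\<integral>\<^sup>+u. indicator {0<..<1::real} u \<partial>lborel)"
      by (intro nn_integral_mono) (auto simp: S_def split: split_indicator)
    then have J1: "?J \<le> 1" by simp
    have J2: "?J \<le> ennreal (16 / (T * (4 * \<bar>s\<bar>)))"
    proof (rule expanding_gaussian_integral[OF S])
      fix u v assume "u \<in> S" "v \<in> S"
      then have "4 * \<bar>s\<bar> * \<bar>u - v\<bar> \<le> \<bar>(mix y z (u + s) - mix y z u) - (mix y z (v + s) - mix y z v)\<bar>"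
        by (intro mix_increment_expanding) (auto simp: S_def)
      from mult_left_mono[OF this, of T]
      show "T * (4 * \<bar>s\<bar>) * \<bar>u - v\<bar> \<le> \<bar>T * (mix y z (u + s) - mix y z u) - T * (mix y z (v + s) - mix y z v)\<bar>"
        using \<open>T > 0\<close> by (simp add: right_diff_distrib[symmetric] abs_mult mult.assoc)
    qed (use assms that in auto)
    obtain j where j: "?J = ennreal j" "0 \<le> j"
      using J1 by (cases ?J) (auto simp: top_unique)
    have "j \<le> (16 / (T * (4 * \<bar>s\<bar>))) powr (1 - e)"
      using J1 J2 j assms that
      by (intro min_one_le_powr) (auto simp: ennreal_le_iff simp flip: ennreal_1)
    also have "\<dots> \<le> (16 / (T * \<bar>s\<bar>)) powr (1 - e)"
      using assms that by (intro powr_mono2) (auto simp: field_simps)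
    also have "\<dots> = 16 powr (1 - e) * (T powr (e - 1) * \<bar>s\<bar> powr (e - 1))"
      using assms that powr_minus_divide[of T "1 - e"] powr_minus_divide[of "\<bar>s\<bar>" "1 - e"]
      by (simp add: powr_divide powr_mult field_simps)
    also have "\<dots> \<le> 16 powr 1 * (T powr (e - 1) * \<bar>s\<bar> powr (e - 1))"
      using assms by (intro mult_right_mono powr_mono) auto
    finally show ?thesis using True unfolding eq j(1)
      by (auto simp: ennreal_mult'[symmetric] mult.assoc abs_less_iff split: split_indicator intro!: ennreal_leI)
  next
    case False
    then have "(\<integral>\<^sup>+u. ?E u (u + s) * ?I (u + s) * ?I u \<partial>lborel) = (\<integral>\<^sup>+u. 0 \<partial>(lborel :: real measure))"
      by (intro nn_integral_cong) (auto split: split_indicator)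
    then show ?thesis by simp
  qed
  have "(\<integral>\<^sup>+u. \<integral>\<^sup>+v. ?E u v \<partial>unif01 \<partial>unif01) = (\<integral>\<^sup>+u. \<integral>\<^sup>+v. ?E u v * ?I v * ?I u \<partial>lborel \<partial>lborel)"
    by (simp add: nn_integral_unif01 nn_integral_multc)
  also have "\<dots> = (\<integral>\<^sup>+u. \<integral>\<^sup>+s. ?E u (u + s) * ?I (u + s) * ?I u \<partial>lborel \<partial>lborel)"
  proof (rule nn_integral_cong)
    fix u :: real
    show "(\<integral>\<^sup>+v. ?E u v * ?I v * ?I u \<partial>lborel) = (\<integral>\<^sup>+s. ?E u (u + s) * ?I (u + s) * ?I u \<partial>lborel)"
      by (subst nn_integral_real_affine[where c=1 and t=u]) auto
  qed
  also have "\<dots> = (\<integral>\<^sup>+s. \<integral>\<^sup>+u. ?E u (u + s) * ?I (u + s) * ?I u \<partial>lborel \<partial>lborel)"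
    by (rule lborel_pair.Fubini') measurable
  \<comment> \<open>The shift s = 0 must be left out, since \<open>0 powr (e - 1)\<close> is 0 while
    the slice there has mass 1; it is a null set.\<close>
  also have "\<dots> \<le> (\<integral>\<^sup>+s. ennreal (16 * T powr (e - 1)) * (ennreal (\<bar>s\<bar> powr (e - 1)) * indicator {-1<..<1} s) \<partial>lborel)"
    using AE_lborel_singleton[of "0::real"] slice by (intro nn_integral_mono_AE) (auto elim: AE_mp)
  also have "\<dots> = ennreal (16 * T powr (e - 1)) * (\<integral>\<^sup>+s. (ennreal (\<bar>s\<bar> powr (e - 1)) * indicator {-1<..<1} s) \<partial>lborel)"
    by (rule nn_integral_cmult) measurable
  also have "\<dots> \<le> ennreal (16 * T powr (e - 1)) * ennreal (2 / e)"
    by (intro mult_left_mono nn_integral_abs_powr assms) auto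
  also have "\<dots> = ennreal (32 / e * T powr (e - 1))"
    using assms by (simp add: ennreal_mult'[symmetric])
  finally show ?thesis .
qed

section \<open>Concentration of the limit law\<close>

locale quicksort_limit =
  fixes M :: "real measure"
  assumes limit_law: "is_quicksort_limit_law M"
begin

sublocale prob_space M
  using limit_law by (simp add: is_quicksort_limit_law_def)

lemma sets_M [measurable_cong]: "sets M = sets borel"
  using limit_law by (simp add: is_quicksort_limit_law_def)

sublocale real_distribution M
  by unfold_locales (use sets_M in \<open>auto dest: sets_eq_imp_space_eq\<close>)

sublocale MM: pair_prob_space M M ..

sublocale U: prob_space unif01
  by (rule prob_space_unif01)

lemma fixed_point:
  "distr (unif01 \<Otimes>\<^sub>M (M \<Otimes>\<^sub>M M)) borel (\<lambda>w. mix (fst (snd w)) (snd (snd w)) (fst w)) = M"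
  using limit_law by (simp add: is_quicksort_limit_law_def mix_def split_beta')

text \<open>Both orders of integration are wanted: with u outermost the integrand factorizes over
  the independent y and z; with (y, z) outermost the inner integral is the characteristic function
  of \<open>mix y z\<close> at a uniform argument.\<close>

lemma char_fixed_point:
  "char M t = (\<integral>u. \<integral>w. iexp (t * mix (fst w) (snd w) u) \<partial>(M \<Otimes>\<^sub>M M) \<partial>unif01)"
  "char M t = (\<integral>w. \<integral>u. iexp (t * mix (fst w) (snd w) u) \<partial>unif01 \<partial>(M \<Otimes>\<^sub>M M))"
proof -
  interpret UMM: pair_prob_space unif01 "M \<Otimes>\<^sub>M M" ..
  let ?f = "\<lambda>w. iexp (t * mix (fst (snd w)) (snd (snd w)) (fst w))"
  have int: "integrable (unif01 \<Otimes>\<^sub>M (M \<Otimes>\<^sub>M M)) ?f"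
    by (rule UMM.integrable_const_bound[where B=1]) auto
  have "char M t = (\<integral>w. iexp (t * w) \<partial>distr (unif01 \<Otimes>\<^sub>M (M \<Otimes>\<^sub>M M)) borel
      (\<lambda>w. mix (fst (snd w)) (snd (snd w)) (fst w)))"
    unfolding fixed_point char_def ..
  also have "\<dots> = (\<integral>w. ?f w \<partial>(unif01 \<Otimes>\<^sub>M (M \<Otimes>\<^sub>M M)))"
    by (subst integral_distr) auto
  finally have *: "char M t = (\<integral>w. ?f w \<partial>(unif01 \<Otimes>\<^sub>M (M \<Otimes>\<^sub>M M)))" .
  show 1: "char M t = (\<integral>u. \<integral>w. iexp (t * mix (fst w) (snd w) u) \<partial>(M \<Otimes>\<^sub>M M) \<partial>unif01)"
    unfolding * using UMM.integral_fst'[OF int] by simp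
  show "char M t = (\<integral>w. \<integral>u. iexp (t * mix (fst w) (snd w) u) \<partial>unif01 \<partial>(M \<Otimes>\<^sub>M M))"
    unfolding 1 by (rule Fubini_bounded[symmetric, where B=1])
      (auto simp: MM.prob_space_axioms U.prob_space_axioms)
qed

text \<open>The characteristic function of the limit is the average over (y, z) of the
  characteristic function \<psi> of \<open>mix y z\<close> at a uniform argument. By Jensen its mean
  square is at most the average of the mean squares of \<psi>, each of which is a Gaussian double
  integral bounded uniformly in y and z by \<open>nn_integral_mix_gaussian\<close>.\<close>

lemma char_mean_square:
  assumes "T > 0" "0 < e" "e < 1"
  shows "(\<integral>\<^sup>+t. ennreal ((cmod (char M (t * T)))\<^sup>2) \<partial>std_normal_distribution)
      \<le> ennreal (32 / e * T powr (e - 1))"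
proof -
  interpret N: real_distribution std_normal_distribution by (rule real_dist_normal_dist)
  interpret NMM: pair_sigma_finite "M \<Otimes>\<^sub>M M" std_normal_distribution ..
  define \<psi> where "\<psi> w t = (\<integral>u. iexp (t * mix (fst w) (snd w) u) \<partial>unif01)" for w t
  have [measurable]: "case_prod \<psi> \<in> borel_measurable ((M \<Otimes>\<^sub>M M) \<Otimes>\<^sub>M borel)"
    unfolding \<psi>_def by measurable
  have [measurable]: "\<psi> w \<in> borel_measurable borel" for w
    unfolding \<psi>_def by measurable
  have \<psi>_le: "cmod (\<psi> w t) \<le> 1" for w t
  proof -
    have "cmod (\<psi> w t) \<le> (\<integral>u. cmod (iexp (t * mix (fst w) (snd w) u)) \<partial>unif01)"
      unfolding \<psi>_def by (rule integral_norm_bound)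
    also have "\<dots> = 1" using U.prob_space by simp
    finally show ?thesis .
  qed
  have jensen: "ennreal ((cmod (char M s))\<^sup>2) \<le> (\<integral>\<^sup>+w. ennreal ((cmod (\<psi> w s))\<^sup>2) \<partial>(M \<Otimes>\<^sub>M M))" for s
  proof -
    have i1: "integrable (M \<Otimes>\<^sub>M M) (\<lambda>w. cmod (\<psi> w s))"
      using \<psi>_le by (intro MM.integrable_const_bound[where B=1]) auto
    have i2: "integrable (M \<Otimes>\<^sub>M M) (\<lambda>w. (cmod (\<psi> w s))\<^sup>2)"
      using \<psi>_le by (intro MM.integrable_const_bound[where B=1]) (auto simp: abs_square_le_1)
    have "cmod (char M s) \<le> (\<integral>w. cmod (\<psi> w s) \<partial>(M \<Otimes>\<^sub>M M))"
      unfolding char_fixed_point(2) \<psi>_def by (rule integral_norm_bound)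
    then have "(cmod (char M s))\<^sup>2 \<le> (\<integral>w. cmod (\<psi> w s) \<partial>(M \<Otimes>\<^sub>M M))\<^sup>2"
      by (intro power_mono) auto
    \<comment> \<open>Jensen for the square, as nonnegativity of the variance.\<close>
    also have "\<dots> \<le> (\<integral>w. (cmod (\<psi> w s))\<^sup>2 \<partial>(M \<Otimes>\<^sub>M M))"
      using MM.variance_eq[OF i1 i2] MM.variance_positive[of "\<lambda>w. cmod (\<psi> w s)"] by simp
    finally show ?thesis
      by (subst nn_integral_eq_integral[OF i2]) (auto intro: ennreal_leI)
  qed
  have inner: "(\<integral>\<^sup>+t. ennreal ((cmod (\<psi> w (t * T)))\<^sup>2) \<partial>std_normal_distribution)
      \<le> ennreal (32 / e * T powr (e - 1))" for w
  proof -
    let ?h = "\<lambda>u. mix (fst w) (snd w) u"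
    let ?P = "distr unif01 borel ?h"
    interpret P: real_distribution ?P
      by (intro real_distribution.intro U.prob_space_distr real_distribution_axioms.intro) auto
    have char_P: "char ?P t = \<psi> w t" for t
      unfolding char_def \<psi>_def by (subst integral_distr) auto
    have "(\<integral>\<^sup>+t. ennreal ((cmod (\<psi> w (t * T)))\<^sup>2) \<partial>std_normal_distribution)
        = ennreal (\<integral>t. (cmod (\<psi> w (t * T)))\<^sup>2 \<partial>std_normal_distribution)"
      using \<psi>_le by (intro nn_integral_eq_integral N.integrable_const_bound[where B=1])
        (auto simp: abs_square_le_1)
    also have "(\<integral>t. (cmod (\<psi> w (t * T)))\<^sup>2 \<partial>std_normal_distribution)
        = (\<integral>x. \<integral>y. exp (- (T * (y - x))\<^sup>2 / 2) \<partial>?P \<partial>?P)"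
      using char_sq_gaussian_smoothing[OF P.real_distribution_axioms, of T] by (simp add: char_P)
    also have "\<dots> = (\<integral>u. \<integral>v. exp (- (T * (?h v - ?h u))\<^sup>2 / 2) \<partial>unif01 \<partial>unif01)"
      by (simp add: integral_distr)
    also have "ennreal \<dots> = (\<integral>\<^sup>+u. ennreal (\<integral>v. exp (- (T * (?h v - ?h u))\<^sup>2 / 2) \<partial>unif01) \<partial>unif01)"
    proof (rule nn_integral_eq_integral[symmetric])
      show "integrable unif01 (\<lambda>u. \<integral>v. exp (- (T * (?h v - ?h u))\<^sup>2 / 2) \<partial>unif01)"
      proof (rule U.integrable_const_bound[where B=1])
        have "(\<integral>v. exp (- (T * (?h v - ?h u))\<^sup>2 / 2) \<partial>unif01) \<le> (\<integral>v. 1 \<partial>unif01)" for u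
          by (intro integral_mono U.integrable_const_bound[where B=1]) auto
        then show "AE u in unif01. norm (\<integral>v. exp (- (T * (?h v - ?h u))\<^sup>2 / 2) \<partial>unif01) \<le> 1"
          using U.prob_space by (intro AE_I2) (simp add: integral_nonneg_AE)
      qed measurable
    qed (simp add: integral_nonneg_AE)
    also have "\<dots> = (\<integral>\<^sup>+u. \<integral>\<^sup>+v. ennreal (exp (- (T * (?h v - ?h u))\<^sup>2 / 2)) \<partial>unif01 \<partial>unif01)"
      by (intro nn_integral_cong nn_integral_eq_integral[symmetric] U.integrable_const_bound[where B=1]) auto
    also have "\<dots> \<le> ennreal (32 / e * T powr (e - 1))"
      by (rule nn_integral_mix_gaussian[OF assms])
    finally show ?thesis .
  qed
  have "(\<integral>\<^sup>+t. ennreal ((cmod (char M (t * T)))\<^sup>2) \<partial>std_normal_distribution)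
      \<le> (\<integral>\<^sup>+t. \<integral>\<^sup>+w. ennreal ((cmod (\<psi> w (t * T)))\<^sup>2) \<partial>(M \<Otimes>\<^sub>M M) \<partial>std_normal_distribution)"
    by (intro nn_integral_mono jensen)
  also have "\<dots> = (\<integral>\<^sup>+w. \<integral>\<^sup>+t. ennreal ((cmod (\<psi> w (t * T)))\<^sup>2) \<partial>std_normal_distribution \<partial>(M \<Otimes>\<^sub>M M))"
    by (rule NMM.Fubini') measurable
  also have "\<dots> \<le> (\<integral>\<^sup>+w. ennreal (32 / e * T powr (e - 1)) \<partial>(M \<Otimes>\<^sub>M M))"
    by (intro nn_integral_mono inner)
  also have "\<dots> = ennreal (32 / e * T powr (e - 1))"
    using MM.emeasure_space_1 by simp
  finally show ?thesis .
qed

text \<open>Given u the two summands are independent, so the characteristic function factorizes; a b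
  <= (a^2 + b^2)/2 then replaces the product by squares, for which \<open>char_mean_square\<close>
  is available.\<close>

lemma cmod_char_le:
  "ennreal (cmod (char M t)) \<le>
    (\<integral>\<^sup>+u. ennreal ((cmod (char M (t * u)))\<^sup>2 / 2) + ennreal ((cmod (char M (t * (1 - u))))\<^sup>2 / 2) \<partial>unif01)"
proof -
  have factor: "(\<integral>w. iexp (t * mix (fst w) (snd w) u) \<partial>(M \<Otimes>\<^sub>M M))
      = iexp (t * toll u) * (char M (t * u) * char M (t * (1 - u)))" for u
  proof -
    have int: "integrable (M \<Otimes>\<^sub>M M) (\<lambda>w. iexp (t * mix (fst w) (snd w) u))"
      by (rule MM.integrable_const_bound[where B=1]) auto
    have "(\<integral>w. iexp (t * mix (fst w) (snd w) u) \<partial>(M \<Otimes>\<^sub>M M))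
        = (\<integral>y. \<integral>z. iexp (t * mix y z u) \<partial>M \<partial>M)"
      using MM.integral_fst'[OF int] by simp
    also have "\<dots> = (\<integral>y. \<integral>z. iexp (t * toll u) * (iexp (t * u * y) * iexp (t * (1 - u) * z)) \<partial>M \<partial>M)"
      by (intro Bochner_Integration.integral_cong refl)
         (simp add: mix_def exp_add[symmetric] algebra_simps)
    finally show ?thesis by (simp add: char_def)
  qed
  have "ennreal (cmod (char M t)) \<le> (\<integral>\<^sup>+u. ennreal (cmod (iexp (t * toll u) * (char M (t * u) * char M (t * (1 - u))))) \<partial>unif01)"
    unfolding char_fixed_point(1)[of t] factor
    by (rule integral_norm_bound_ennreal, rule U.integrable_const_bound[where B=1])
       (auto simp: norm_mult cmod_char_le_1 mult_le_one)
  also have "\<dots> \<le> (\<integral>\<^sup>+u. ennreal ((cmod (char M (t * u)))\<^sup>2 / 2) + ennreal ((cmod (char M (t * (1 - u))))\<^sup>2 / 2) \<partial>unif01)"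
  proof (intro nn_integral_mono)
    fix u
    have "cmod (char M (t * u)) * cmod (char M (t * (1 - u)))
        \<le> (cmod (char M (t * u)))\<^sup>2 / 2 + (cmod (char M (t * (1 - u))))\<^sup>2 / 2"
      using sum_squares_bound[of "cmod (char M (t * u))" "cmod (char M (t * (1 - u)))"] by simp
    then show "ennreal (cmod (iexp (t * toll u) * (char M (t * u) * char M (t * (1 - u)))))
        \<le> ennreal ((cmod (char M (t * u)))\<^sup>2 / 2) + ennreal ((cmod (char M (t * (1 - u))))\<^sup>2 / 2)"
      by (simp add: norm_mult ennreal_leI flip: ennreal_plus)
  qed
  finally show ?thesis .
qed

lemma nn_integral_unif01_powr:
  assumes "0 < e"
  shows "(\<integral>\<^sup>+u. ennreal (u powr (e - 1)) \<partial>unif01) \<le> ennreal (1 / e)"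
    and "(\<integral>\<^sup>+u. ennreal ((1 - u) powr (e - 1)) \<partial>unif01) \<le> ennreal (1 / e)"
proof -
  show "(\<integral>\<^sup>+u. ennreal (u powr (e - 1)) \<partial>unif01) \<le> ennreal (1 / e)"
    unfolding nn_integral_powr_01[OF assms, symmetric]
    by (subst nn_integral_unif01) (auto intro!: nn_integral_mono split: split_indicator)
  have "(\<integral>\<^sup>+u. ennreal ((1 - u) powr (e - 1)) \<partial>unif01)
      = (\<integral>\<^sup>+u. ennreal ((1 - u) powr (e - 1)) * indicator {0<..<1} u \<partial>lborel)"
    by (rule nn_integral_unif01) measurable
  also have "\<dots> = (\<integral>\<^sup>+u. ennreal (u powr (e - 1)) * indicator {0<..<1} u \<partial>lborel)"
    by (subst nn_integral_real_affine[where c="-1" and t=1])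
       (auto intro!: nn_integral_cong split: split_indicator)
  also have "\<dots> \<le> ennreal (1 / e)"
    unfolding nn_integral_powr_01[OF assms, symmetric]
    by (auto intro!: nn_integral_mono split: split_indicator)
  finally show "(\<integral>\<^sup>+u. ennreal ((1 - u) powr (e - 1)) \<partial>unif01) \<le> ennreal (1 / e)" .
qed

text \<open>\<open>cmod_char_le\<close> bounds the first power at frequency t T by squares at t T u
  and t T (1 - u). Their Gaussian averages are of order (T u)^(e-1) and (T (1 - u))^(e-1), and
  integrating over u costs only another factor 1/e.\<close>

lemma char_mean:
  assumes "T > 0" "0 < e" "e < 1"
  shows "(\<integral>t. cmod (char M (t * T)) \<partial>std_normal_distribution) \<le> 32 / e\<^sup>2 * T powr (e - 1)"
proof -
  interpret N: real_distribution std_normal_distribution by (rule real_dist_normal_dist)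
  interpret UN: pair_sigma_finite unif01 std_normal_distribution ..
  \<comment> \<open>The mean-square bound at scale T, halved as in
    \<open>cmod_char_le\<close>.\<close>
  define K where "K = 32 / e * T powr (e - 1) / 2"
  have K: "0 \<le> K" using assms by (simp add: K_def)
  let ?S = "\<lambda>s. (\<integral>\<^sup>+t. ennreal ((cmod (char M (t * s)))\<^sup>2 / 2) \<partial>std_normal_distribution)"
  have S: "?S (T * u) \<le> ennreal K * ennreal (u powr (e - 1))" if "0 < u" for u
  proof -
    have "?S (T * u) = (\<integral>\<^sup>+t. ennreal (1/2) * ennreal ((cmod (char M (t * (T * u))))\<^sup>2) \<partial>std_normal_distribution)"
      by (intro nn_integral_cong, subst ennreal_mult'[symmetric]) auto
    also have "\<dots> = ennreal (1/2) * (\<integral>\<^sup>+t. ennreal ((cmod (char M (t * (T * u))))\<^sup>2) \<partial>std_normal_distribution)"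
      by (rule nn_integral_cmult) measurable
    also have "\<dots> \<le> ennreal (1/2) * ennreal (32 / e * (T * u) powr (e - 1))"
      using assms that by (intro mult_left_mono char_mean_square) auto
    also have "\<dots> = ennreal (1/2 * (32 / e * (T * u) powr (e - 1)))"
      by (rule ennreal_mult'[symmetric]) simp
    also have "1/2 * (32 / e * (T * u) powr (e - 1)) = K * u powr (e - 1)"
      using assms that by (simp add: K_def powr_mult)
    also have "ennreal \<dots> = ennreal K * ennreal (u powr (e - 1))"
      by (rule ennreal_mult'[OF K])
    finally show ?thesis .
  qed
  have "ennreal (\<integral>t. cmod (char M (t * T)) \<partial>std_normal_distribution)
      = (\<integral>\<^sup>+t. ennreal (cmod (char M (t * T))) \<partial>std_normal_distribution)"
    by (intro nn_integral_eq_integral[symmetric] N.integrable_const_bound[where B=1])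
       (auto simp: cmod_char_le_1)
  also have "\<dots> \<le> (\<integral>\<^sup>+t. \<integral>\<^sup>+u. ennreal ((cmod (char M (t * (T * u))))\<^sup>2 / 2)
      + ennreal ((cmod (char M (t * (T * (1 - u)))))\<^sup>2 / 2) \<partial>unif01 \<partial>std_normal_distribution)"
    by (intro nn_integral_mono) (rule cmod_char_le[of "_ * T", unfolded mult.assoc])
  also have "\<dots> = (\<integral>\<^sup>+u. \<integral>\<^sup>+t. ennreal ((cmod (char M (t * (T * u))))\<^sup>2 / 2)
      + ennreal ((cmod (char M (t * (T * (1 - u)))))\<^sup>2 / 2) \<partial>std_normal_distribution \<partial>unif01)"
    by (rule UN.Fubini') measurable
  also have "\<dots> = (\<integral>\<^sup>+u. ?S (T * u) + ?S (T * (1 - u)) \<partial>unif01)"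
    by (intro nn_integral_cong nn_integral_add) auto
  also have "\<dots> \<le> (\<integral>\<^sup>+u. ennreal K * ennreal (u powr (e - 1)) + ennreal K * ennreal ((1 - u) powr (e - 1)) \<partial>unif01)"
    by (rule nn_integral_mono_AE, use AE_unif01 in eventually_elim) (auto intro!: add_mono S)
  also have "\<dots> = ennreal K * (\<integral>\<^sup>+u. ennreal (u powr (e - 1)) \<partial>unif01)
      + ennreal K * (\<integral>\<^sup>+u. ennreal ((1 - u) powr (e - 1)) \<partial>unif01)"
    by (subst nn_integral_add) (auto simp: nn_integral_cmult)
  also have "\<dots> \<le> ennreal K * ennreal (1 / e) + ennreal K * ennreal (1 / e)"
    using assms by (intro add_mono mult_left_mono nn_integral_unif01_powr) auto
  also have "\<dots> = ennreal (32 / e\<^sup>2 * T powr (e - 1))"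
    using assms K by (simp add: K_def power2_eq_square flip: ennreal_mult' ennreal_plus)
  finally show ?thesis
    using assms by (subst (asm) ennreal_le_iff) auto
qed

text \<open>The smoothing inequality at T = 1/h; 64 is twice 32, as exp(1/2) <= 2.\<close>

lemma concentration:
  assumes "0 < e" "e < 1" "h > 0"
  shows "measure M {x - h..x + h} \<le> 64 / e\<^sup>2 * h powr (1 - e)"
proof -
  have "measure M {x - h..x + h} \<le> exp (1/2) * (32 / e\<^sup>2 * (1 / h) powr (e - 1))"
    using concentration_le_char[OF real_distribution_axioms \<open>h > 0\<close>, of x]
      char_mean[of "1 / h" e] assms by (smt (verit) divide_pos_pos exp_gt_zero mult_le_cancel_left_pos)
  also have "\<dots> \<le> 2 * (32 / e\<^sup>2 * (1 / h) powr (e - 1))"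
    by (intro mult_right_mono exp_bound_half[of "1/2::real", simplified]) auto
  also have "(1 / h) powr (e - 1) = h powr (1 - e)"
    using assms by (simp add: powr_divide powr_diff)
  finally show ?thesis by simp
qed

end

section \<open>Elementary inequalities and the mean number of comparisons\<close>

text \<open>Either y <= \<eta> x, and x + y <= (1 + \<eta>) x, or x < y/\<eta> and y dominates. With
  \<eta> taken from (1 + \<eta>)^q = 1 + \<delta>, a perturbation y raises the factor of x^q by as
  little as desired.\<close>

lemma power_add_le_split:
  fixes \<delta> :: real
  assumes "\<delta> > 0" "q > 0"
  obtains D where "D \<ge> 0" "\<And>x y. \<lbrakk>0 \<le> x; 0 \<le> y\<rbrakk> \<Longrightarrow> (x + y) ^ q \<le> (1 + \<delta>) * x ^ q + D * y ^ q"
proof -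
  define \<eta> where "\<eta> = root q (1 + \<delta>) - 1"
  have "root q 1 < root q (1 + \<delta>)" using assms by (intro real_root_less_mono) auto
  then have \<eta>: "\<eta> > 0" "(1 + \<eta>) ^ q = 1 + \<delta>" using assms by (auto simp: \<eta>_def)
  show thesis
  proof
    show "(1 + 1 / \<eta>) ^ q \<ge> 0" using \<eta> by simp
    fix x y :: real assume xy: "0 \<le> x" "0 \<le> y"
    show "(x + y) ^ q \<le> (1 + \<delta>) * x ^ q + (1 + 1 / \<eta>) ^ q * y ^ q"
    proof (cases "y \<le> \<eta> * x")
      case True
      then have "(x + y) ^ q \<le> ((1 + \<eta>) * x) ^ q" using xy by (intro power_mono) (auto simp: algebra_simps)
      then show ?thesis using xy \<eta> by (simp add: power_mult_distrib add_increasing2)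
    next
      case False
      then have "(x + y) ^ q \<le> ((1 + 1 / \<eta>) * y) ^ q" using xy \<eta> by (intro power_mono) (auto simp: field_simps)
      then show ?thesis using xy assms by (simp add: power_mult_distrib add_increasing)
    qed
  qed
qed

text \<open>The mixed term is \<open>x\<^sup>p y\<^sup>p\<close>, so for independent summands a bound on moments of order \<open>p\<close>
  controls those of order \<open>2p\<close> without any cancellation.\<close>

lemma power_double_add_le_split:
  fixes \<delta> :: real
  assumes "\<delta> > 0" "p > 0"
  obtains D where "D \<ge> 0" "\<And>x y. \<lbrakk>0 \<le> x; 0 \<le> y\<rbrakk> \<Longrightarrow>
    (x + y) ^ (2 * p) \<le> (1 + \<delta>) * (x ^ (2 * p) + y ^ (2 * p)) + D * (x ^ p * y ^ p)"
proof -
  define \<eta> where "\<eta> = root (2 * p) (1 + \<delta>) - 1"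
  have "root (2 * p) 1 < root (2 * p) (1 + \<delta>)" using assms by (intro real_root_less_mono) auto
  then have \<eta>: "\<eta> > 0" "(1 + \<eta>) ^ (2 * p) = 1 + \<delta>" using assms by (auto simp: \<eta>_def)
  \<comment> \<open>For y <= x with y > \<eta> x one has (x + y)^2 <= 4 x^2 <= (4/\<eta>) x y, so
    this D covers that case.\<close>
  define D where "D = (4 / \<eta>) ^ p"
  have D: "D \<ge> 0" using \<eta> by (simp add: D_def)
  have *: "(x + y) ^ (2 * p) \<le> (1 + \<delta>) * (x ^ (2 * p) + y ^ (2 * p)) + D * (x ^ p * y ^ p)"
    if xy: "0 \<le> y" "y \<le> x" for x y
  proof (cases "y \<le> \<eta> * x")
    case True
    then have "(x + y) ^ (2 * p) \<le> ((1 + \<eta>) * x) ^ (2 * p)" using xy by (intro power_mono) (auto simp: algebra_simps)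
    also have "\<dots> = (1 + \<delta>) * x ^ (2 * p)" using \<eta> by (simp only: power_mult_distrib)
    also have "\<dots> \<le> (1 + \<delta>) * (x ^ (2 * p) + y ^ (2 * p)) + D * (x ^ p * y ^ p)"
      using xy D assms by (intro add_increasing2 mult_left_mono) auto
    finally show ?thesis .
  next
    case False
    have "(x + y) ^ (2 * p) \<le> (2 * x) ^ (2 * p)" using xy by (intro power_mono) auto
    also have "\<dots> = (4 * (x * x)) ^ p" by (simp add: power_mult power2_eq_square)
    also have "\<dots> \<le> (4 / \<eta> * (x * y)) ^ p"
    proof (rule power_mono)
      have "x * (\<eta> * x) \<le> x * y" using False xy by (intro mult_left_mono) auto
      then show "4 * (x * x) \<le> 4 / \<eta> * (x * y)" using \<eta> by (simp add: field_simps)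
    qed (use xy in auto)
    also have "\<dots> = D * (x ^ p * y ^ p)" by (simp only: D_def power_mult_distrib)
    also have "\<dots> \<le> (1 + \<delta>) * (x ^ (2 * p) + y ^ (2 * p)) + D * (x ^ p * y ^ p)"
      using xy assms by (intro add_increasing mult_nonneg_nonneg) auto
    finally show ?thesis .
  qed
  show thesis
  proof (rule that[OF D])
    fix x y :: real assume "0 \<le> x" "0 \<le> y"
    then show "(x + y) ^ (2 * p) \<le> (1 + \<delta>) * (x ^ (2 * p) + y ^ (2 * p)) + D * (x ^ p * y ^ p)"
      using *[of x y] *[of y x] by (cases "y \<le> x") (auto simp: add.commute mult.commute)
  qed
qed

section \<open>Power sums and the divide-and-conquer recursion\<close>

lemma bernoulli_powr:
  fixes x s :: real
  assumes "x \<ge> 0" "s \<ge> 1"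
  shows "1 + s * x \<le> (1 + x) powr s"
proof -
  have "(1 + 0) powr s - s * 0 \<le> (1 + x) powr s - s * x"
  proof (rule DERIV_nonneg_imp_nondecreasing[OF \<open>x \<ge> 0\<close>, of "\<lambda>x. (1 + x) powr s - s * x"])
    fix z :: real assume "0 \<le> z"
    then have "((\<lambda>x. (1 + x) powr s - s * x) has_real_derivative s * (1 + z) powr (s - 1) - s) (at z)"
      by (auto intro!: derivative_eq_intros)
    moreover have "(1 + z) powr (s - 1) \<ge> 1" using \<open>0 \<le> z\<close> assms by (intro ge_one_powr_ge_zero) auto
    ultimately show "\<exists>d. ((\<lambda>x. (1 + x) powr s - s * x) has_real_derivative d) (at z) \<and> 0 \<le> d"
      using assms by (intro exI[of _ "s * (1 + z) powr (s - 1) - s"]) (auto simp: mult_le_cancel_left1)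
  qed
  then show ?thesis by simp
qed

text \<open>Discrete form of the integral of x^s, keeping the sharp factor 1/(s + 1), which decides
  when the recursion below contracts. Bernoulli's inequality at 1/(n + 2) gives the induction
  step.\<close>

lemma sum_powr_le:
  fixes s :: real
  assumes "s \<ge> 1"
  shows "(\<Sum>k\<le>n. (real k + 1) powr s) \<le> (real n + 1) * (real n + 2) powr s / (s + 1)"
proof (induction n)
  case 0
  show ?case using bernoulli_powr[of 1 s] assms by (simp add: field_simps)
next
  case (Suc n)
  have "real (Suc n) + 1 = real n + 2" by simp
  then have "(\<Sum>k\<le>Suc n. (real k + 1) powr s) \<le> (real n + 1) * (real n + 2) powr s / (s + 1) + (real n + 2) powr s"
    using Suc by (simp only: sum.atMost_Suc)
  also have "\<dots> = (real n + 2) powr s * (real n + 2 + s) / (s + 1)"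
    using assms by (simp add: field_simps)
  also have "real n + 2 + s = (real n + 2) * (1 + s * (1 / (real n + 2)))"
    by (simp add: field_simps)
  also have "(real n + 2) powr s * ((real n + 2) * (1 + s * (1 / (real n + 2)))) / (s + 1)
      \<le> (real n + 2) powr s * ((real n + 2) * (1 + 1 / (real n + 2)) powr s) / (s + 1)"
    using assms by (intro divide_right_mono mult_left_mono bernoulli_powr) auto
  also have "\<dots> = (real n + 2) * ((real n + 2) * (1 + 1 / (real n + 2))) powr s / (s + 1)"
    by (simp add: powr_mult)
  also have "(real n + 2) * (1 + 1 / (real n + 2)) = real n + 3" by (simp add: field_simps)
  finally show ?case by (simp add: add.commute)
qed

text \<open>Inserting K (k + 1)^s on the right-hand side reproduces the same power with factor 2
  \<theta> K/(s + 1) + C, because the terms of both subproblem sizes k and n - k are averaged. A K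
  with this factor equal to K exists as 2 \<theta> < s + 1.\<close>

lemma divide_and_conquer_recursion:
  fixes a :: "nat \<Rightarrow> ennreal" and I :: "nat \<Rightarrow> nat \<Rightarrow> ennreal"
  assumes "s \<ge> 1" "\<theta> \<ge> 0" "2 * \<theta> < s + 1" "C \<ge> 0"
    and a0: "a 0 \<le> ennreal C"
    and aS: "\<And>n. a (Suc n) = (\<Sum>k\<le>n. I n k) / ennreal (real n + 1)"
    and I: "\<And>n k. k \<le> n \<Longrightarrow> I n k \<le> ennreal \<theta> * (a k + a (n - k)) + ennreal (C * (real n + 2) powr s)"
  obtains K where "K \<ge> 0" "\<And>n. a n \<le> ennreal (K * (real n + 1) powr s)"
proof -
  define K where "K = C * (s + 1) / (s + 1 - 2 * \<theta>)"
  have K: "K \<ge> 0" using assms by (simp add: K_def)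
  have K_eq: "2 * \<theta> * K / (s + 1) + C = K"
    using assms by (simp add: K_def divide_simps) (simp add: algebra_simps)
  have K_C: "C \<le> K" using K_eq K assms by (smt (verit) divide_nonneg_nonneg mult_nonneg_nonneg)
  have "a n \<le> ennreal (K * (real n + 1) powr s)" for n
  proof (induction n rule: less_induct)
    case (less n)
    show ?case
    proof (cases n)
      case 0
      then show ?thesis using a0 K_C by (auto intro: order.trans ennreal_leI)
    next
      case (Suc m)
      let ?p = "\<lambda>k. (real k + 1) powr s"
      have Ib: "I m k \<le> ennreal (\<theta> * K * (?p k + ?p (m - k)) + C * (real m + 2) powr s)" if "k \<le> m" for k
      proof -
        have "I m k \<le> ennreal \<theta> * (ennreal (K * ?p k) + ennreal (K * ?p (m - k))) + ennreal (C * (real m + 2) powr s)"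
          using that Suc by (intro order.trans[OF I[OF that]] add_mono mult_left_mono less.IH) auto
        also have "\<dots> = ennreal (\<theta> * K * (?p k + ?p (m - k)) + C * (real m + 2) powr s)"
          using K assms by (simp add: algebra_simps flip: ennreal_plus ennreal_mult')
        finally show ?thesis .
      qed
      have "(\<Sum>k\<le>m. I m k) \<le> (\<Sum>k\<le>m. ennreal (\<theta> * K * (?p k + ?p (m - k)) + C * (real m + 2) powr s))"
        by (intro sum_mono Ib) auto
      also have "\<dots> = ennreal (\<Sum>k\<le>m. \<theta> * K * (?p k + ?p (m - k)) + C * (real m + 2) powr s)"
        using K assms by (intro sum_ennreal) auto
      also have "(\<Sum>k\<le>m. \<theta> * K * (?p k + ?p (m - k)) + C * (real m + 2) powr s)
          = \<theta> * K * ((\<Sum>k\<le>m. ?p k) + (\<Sum>k\<le>m. ?p (m - k))) + (real m + 1) * (C * (real m + 2) powr s)"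
        by (simp add: sum.distrib sum_distrib_left distrib_left del: of_nat_diff)
      also have "(\<Sum>k\<le>m. ?p (m - k)) = (\<Sum>k\<le>m. ?p k)"
        by (rule sum.reindex_bij_witness[of _ "\<lambda>k. m - k" "\<lambda>k. m - k"]) auto
      also have "\<theta> * K * ((\<Sum>k\<le>m. ?p k) + (\<Sum>k\<le>m. ?p k)) + (real m + 1) * (C * (real m + 2) powr s)
          \<le> \<theta> * K * (2 * ((real m + 1) * (real m + 2) powr s / (s + 1))) + (real m + 1) * (C * (real m + 2) powr s)"
        using sum_powr_le[OF \<open>s \<ge> 1\<close>, of m] K assms by (intro add_mono mult_left_mono) auto
      also have "\<dots> = (real m + 1) * ((2 * \<theta> * K / (s + 1) + C) * (real m + 2) powr s)"
        by (simp add: field_simps)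
      also have "\<dots> = (real m + 1) * (K * (real m + 2) powr s)"
        unfolding K_eq ..
      finally have "(\<Sum>k\<le>m. I m k) \<le> ennreal ((real m + 1) * (K * (real m + 2) powr s))"
        by (simp add: ennreal_leI)
      then have "a n \<le> ennreal ((real m + 1) * (K * (real m + 2) powr s)) / ennreal (real m + 1)"
        unfolding Suc aS by (rule divide_right_mono_ennreal)
      also have "\<dots> = ennreal (K * (real m + 2) powr s)"
        using K by (subst divide_ennreal) auto
      finally show ?thesis using Suc by (simp add: add.commute)
    qed
  qed
  then show thesis using that K by blast
qed

section \<open>Asymptotics of the mean and of the centered cost of a split\<close>

definition xlnx :: "real \<Rightarrow> real" where
  "xlnx x = 2 * x * ln x"

lemma xlnx_increment:
  assumes "0 < x" "x \<le> y" "y \<le> x + 1" "1 \<le> y"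
  shows "\<bar>xlnx y - xlnx x\<bar> \<le> 2 * (ln y + 1)"
proof -
  have ln_y: "0 \<le> ln y" using assms by simp
  have "y * ln y - x * ln x = (y - x) * ln y + x * ln (y / x)"
    using assms by (simp add: ln_div algebra_simps)
  also have "x * ln (y / x) \<le> x * (y / x - 1)"
    using assms by (intro mult_left_mono ln_le_minus_one) auto
  also have "\<dots> = y - x" using assms by (simp add: field_simps)
  also have "(y - x) * ln y + (y - x) \<le> 1 * ln y + 1"
    using assms ln_y by (intro add_mono mult_right_mono) auto
  finally have upper: "y * ln y - x * ln x \<le> ln y + 1" by simp
  have "x * ln x \<le> y * ln y"
  proof (cases "x \<le> 1")
    case True
    then have "x * ln x \<le> 0" using assms by (simp add: mult_nonneg_nonpos)
    then show ?thesis using assms ln_y by (smt (verit) mult_nonneg_nonneg)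
  qed (use assms in \<open>auto intro!: mult_mono\<close>)
  then show ?thesis using upper by (simp add: xlnx_def)
qed

text \<open>The bounds on H_n - ln (n + 1) minus Euler's constant are of order 1/n; multiplied by 2
  (n + 1) they stay within [-2, 0]. The size n = 0, outside their range, has r equal to minus twice
  Euler's constant.\<close>

lemma qs_mean_approx:
  "\<exists>r\<in>{-2..0}. qs_mean n = xlnx (real n + 1) + 2 * euler_mascheroni * (real n + 1) - 4 * real n + r"
proof (cases "n = 0")
  case True
  have "euler_mascheroni < (1::real)"
    using euler_mascheroni_upper[of 0] ln2_ge_two_thirds by (simp add: harm_def)
  then show ?thesis using True euler_mascheroni_pos
    by (intro bexI[of _ "- 2 * euler_mascheroni"]) (auto simp: qs_mean_def xlnx_def harm_def)
next
  case False
  define d where "d = harm n - ln (real n + 1) - euler_mascheroni"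
  have "d \<le> - inverse (2 * (real n + 1))" "- inverse (2 * real n) \<le> d"
    using euler_mascheroni_bounds[of n] False by (auto simp: d_def add.commute)
  moreover have "0 \<le> inverse (2 * (real n + 1))" by simp
  ultimately have d: "d \<le> 0" "- 1 / (2 * real n) \<le> d"
    by (linarith, simp only: inverse_eq_divide minus_divide_left)
  have "- 2 \<le> 2 * (real n + 1) * (- 1 / (2 * real n))" using False by (simp add: field_simps)
  also have "\<dots> \<le> 2 * (real n + 1) * d" using d by (intro mult_left_mono) auto
  finally have "2 * (real n + 1) * d \<in> {-2..0}" using d by (auto simp: mult_nonneg_nonpos)
  then show ?thesis
    by (rule bexI[rotated]) (simp add: qs_mean_def xlnx_def d_def algebra_simps)
qed

text \<open>Given a pivot that leaves k and n - k elements, the centered count of size n + 1 exceeds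
  the sum of the centered subproblem counts by exactly this. It is the discrete counterpart of (n +
  1) \<open>toll\<close>.\<close>

definition split_cost :: "nat \<Rightarrow> nat \<Rightarrow> real" where
  "split_cost n k = real n + qs_mean k + qs_mean (n - k) - qs_mean (Suc n)"

text \<open>The linear terms cancel up to a bounded remainder, and the x ln x terms combine to the
  toll up to increments over steps of length at most 1, each of order ln n. The logarithm is then
  weakened to a square root, which is small enough for every exponent \<alpha> > 1/2 below.\<close>

lemma split_cost_approx:
  assumes "k \<le> n" "0 < v" "v < 1"
  shows "\<bar>split_cost n k - (real n + 1) * toll ((real k + v) / (real n + 1))\<bar>
      \<le> 25 * (real n + 2) powr (1/2)"
proof -
  obtain rk where rk: "rk \<in> {-2..0}" and mk: "qs_mean k = xlnx (real k + 1) + 2 * euler_mascheroni * (real k + 1) - 4 * real k + rk"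
    using qs_mean_approx by blast
  obtain rm where rm: "rm \<in> {-2..0}" and mm: "qs_mean (n - k) = xlnx (real (n - k) + 1) + 2 * euler_mascheroni * (real (n - k) + 1) - 4 * real (n - k) + rm"
    using qs_mean_approx by blast
  obtain rn where rn: "rn \<in> {-2..0}" and mn: "qs_mean (Suc n) = xlnx (real (Suc n) + 1) + 2 * euler_mascheroni * (real (Suc n) + 1) - 4 * real (Suc n) + rn"
    using qs_mean_approx by blast
  define m where "m = real n - real k"
  have m: "real (n - k) = m" "m \<ge> 0" using assms by (auto simp: m_def of_nat_diff)
  define u where "u = (real k + v) / (real n + 1)"
  have u: "(real n + 1) * u = real k + v" "(real n + 1) * (1 - u) = m + (1 - v)"
    by (simp_all add: u_def m_def field_simps)
  have lnu: "ln u = ln (real k + v) - ln (real n + 1)" "ln (1 - u) = ln (m + (1 - v)) - ln (real n + 1)"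
  proof -
    show "ln u = ln (real k + v) - ln (real n + 1)" unfolding u_def using assms by (simp add: ln_div)
    have "1 - u = (m + (1 - v)) / (real n + 1)" by (simp add: u_def m_def field_simps)
    then show "ln (1 - u) = ln (m + (1 - v)) - ln (real n + 1)" using assms m by (simp add: ln_div)
  qed
  have "(real n + 1) * toll u = 2 * ((real n + 1) * u) * ln u + 2 * ((real n + 1) * (1 - u)) * ln (1 - u) + (real n + 1)"
    by (simp add: toll_def algebra_simps)
  also have "\<dots> = xlnx (real k + v) + xlnx (m + (1 - v)) - xlnx (real n + 1) + real n + 1"
    unfolding u lnu by (simp add: xlnx_def m_def algebra_simps)
  finally have "split_cost n k - (real n + 1) * toll u
      = 3 + (xlnx (real k + 1) - xlnx (real k + v)) + (xlnx (m + 1) - xlnx (m + (1 - v)))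
        - (xlnx (real n + 2) - xlnx (real n + 1)) + rk + rm - rn"
    unfolding split_cost_def mk mm mn m by (simp add: m_def algebra_simps)
  moreover have "\<bar>xlnx (real k + 1) - xlnx (real k + v)\<bar> \<le> 2 * (ln (real n + 2) + 1)"
    using assms by (intro order.trans[OF xlnx_increment]) auto
  moreover have "\<bar>xlnx (m + 1) - xlnx (m + (1 - v))\<bar> \<le> 2 * (ln (real n + 2) + 1)"
    using assms m by (intro order.trans[OF xlnx_increment]) (auto simp: m_def)
  moreover have "\<bar>xlnx (real n + 2) - xlnx (real n + 1)\<bar> \<le> 2 * (ln (real n + 2) + 1)"
    by (intro order.trans[OF xlnx_increment]) auto
  ultimately have "\<bar>split_cost n k - (real n + 1) * toll u\<bar> \<le> 13 + 6 * ln (real n + 2)"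
    using rk rm rn by auto
  also have "ln (real n + 2) \<le> (real n + 2) powr (1/2) / (1/2)"
    by (rule ln_powr_bound) auto
  also have "13 + 6 * ((real n + 2) powr (1/2) / (1/2)) \<le> 25 * (real n + 2) powr (1/2)"
    using ge_one_powr_ge_zero[of "real n + 2" "1/2"] by simp
  finally show ?thesis by (simp add: u_def)
qed

lemma toll_bounded:
  assumes "0 < u" "u < 1"
  shows "\<bar>toll u\<bar> \<le> 5"
proof -
  have *: "- 1 \<le> x * ln x \<and> x * ln x \<le> 0" if "0 < x" "x < 1" for x :: real
  proof -
    have "x * (1 - 1 / x) \<le> x * ln x"
      using that ln_le_minus_one[of "1 / x"] by (intro mult_left_mono) (auto simp: ln_div)
    then show ?thesis using that by (auto simp: algebra_simps mult_nonneg_nonpos)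
  qed
  have "toll u = 2 * (u * ln u) + 2 * ((1 - u) * ln (1 - u)) + 1"
    by (simp add: toll_def algebra_simps)
  then show ?thesis using *[of u] *[of "1 - u"] assms by linarith
qed

text \<open>Serves the comparison with weight c = 0, where no toll is subtracted: 5 from the bounded
  toll plus 25 from the approximation at v = 1/2.\<close>

lemma split_cost_linear:
  assumes "k \<le> n"
  shows "\<bar>split_cost n k\<bar> \<le> 30 * (real n + 2)"
proof -
  have u: "0 < (real k + 1/2) / (real n + 1)" "(real k + 1/2) / (real n + 1) < 1"
    using assms by (auto simp: field_simps)
  have "\<bar>(real n + 1) * toll ((real k + 1/2) / (real n + 1))\<bar> \<le> (real n + 1) * 5"
    unfolding abs_mult using toll_bounded[OF u] by (intro mult_mono) auto
  moreover have "(real n + 2) powr (1/2) \<le> (real n + 2) powr 1"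
    by (intro powr_mono) auto
  ultimately show ?thesis using split_cost_approx[OF assms, of "1/2"]
    by simp
qed

section \<open>The expected number of comparisons\<close>

lemma qs_mean_recursion:
  "(real n + 1) * (qs_mean (Suc n) - real n) = 2 * (\<Sum>k\<le>n. qs_mean k)"
proof (induction n)
  case 0
  show ?case by (simp add: qs_mean_def harm_def)
next
  case (Suc n)
  have "2 * (\<Sum>k\<le>Suc n. qs_mean k) = (real n + 1) * (qs_mean (Suc n) - real n) + 2 * qs_mean (Suc n)"
    using Suc by simp
  also have "\<dots> = (real (Suc n) + 1) * (qs_mean (Suc (Suc n)) - real (Suc n))"
    by (simp add: qs_mean_def harm_Suc divide_simps) (simp add: algebra_simps)
  finally show ?case ..
qed

lemma finite_qs_comparisons [simp]: "finite (set_pmf (qs_comparisons n))"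
proof (induction n rule: less_induct)
  case (less n)
  then show ?case by (cases n) (auto simp: less_Suc_eq_le)
qed

text \<open>Replacing the pivot rank by k = u - 1 indexes the recursion by the size of the left
  subproblem, the form shared with the coupling.\<close>

lemma qs_comparisons_Suc:
  "qs_comparisons (Suc n) = bind_pmf (pmf_of_set {..n}) (\<lambda>k.
     map_pmf (\<lambda>(a, b). a + b + n) (pair_pmf (qs_comparisons k) (qs_comparisons (n - k))))"
proof -
  have "pmf_of_set {1..Suc n} = map_pmf Suc (pmf_of_set {..n})"
  proof (subst map_pmf_of_set_inj)
    show "pmf_of_set {1..Suc n} = pmf_of_set (Suc ` {..n})" by (simp add: image_Suc_atMost)
  qed auto
  then show ?thesis
    by (simp add: bind_map_pmf pair_pmf_def map_bind_pmf)
qed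

text \<open>Identifies the centering constant of \<open>Yn_law\<close> as the true mean. This makes
  the coupling errors centered and so kills the cross term in their second moments.\<close>

lemma expectation_qs_comparisons: "measure_pmf.expectation (qs_comparisons n) real = qs_mean n"
proof (induction n rule: less_induct)
  case (less n)
  show ?case
  proof (cases n)
    case 0
    then show ?thesis by (simp add: qs_mean_def harm_def)
  next
    case (Suc m)
    have pair: "measure_pmf.expectation (map_pmf (\<lambda>(a, b). a + b + m) (pair_pmf (qs_comparisons k) (qs_comparisons (m - k)))) real
        = qs_mean k + qs_mean (m - k) + real m" if "k \<le> m" for k
    proof -
      let ?p = "pair_pmf (qs_comparisons k) (qs_comparisons (m - k))"
      have int: "integrable ?p f" for f :: "nat \<times> nat \<Rightarrow> real"
        by (intro integrable_measure_pmf_finite) auto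
      have "measure_pmf.expectation (map_pmf (\<lambda>(a, b). a + b + m) ?p) real
          = measure_pmf.expectation ?p (\<lambda>w. real (fst w) + real (snd w) + real m)"
        by (simp add: split_beta')
      also have "\<dots> = measure_pmf.expectation ?p (\<lambda>w. real (fst w)) + measure_pmf.expectation ?p (\<lambda>w. real (snd w)) + real m"
        by (simp add: int)
      also have "measure_pmf.expectation ?p (\<lambda>w. real (fst w)) = measure_pmf.expectation (map_pmf fst ?p) real"
        by simp
      also have "measure_pmf.expectation ?p (\<lambda>w. real (snd w)) = measure_pmf.expectation (map_pmf snd ?p) real"
        by simp
      finally show ?thesis using that Suc by (simp add: map_fst_pair_pmf map_snd_pair_pmf less.IH)
    qed
    have "measure_pmf.expectation (qs_comparisons n) real
        = (\<Sum>k\<le>m. measure_pmf.expectation (map_pmf (\<lambda>(a, b). a + b + m) (pair_pmf (qs_comparisons k) (qs_comparisons (m - k)))) real /\<^sub>R real (card {..m}))"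
      unfolding Suc qs_comparisons_Suc by (rule pmf_expectation_bind_pmf_of_set) auto
    also have "\<dots> = (\<Sum>k\<le>m. (qs_mean k + qs_mean (m - k) + real m) / (real m + 1))"
      by (intro sum.cong refl) (subst pair, auto simp: divide_inverse add.commute mult.commute)
    also have "\<dots> = (\<Sum>k\<le>m. qs_mean k + qs_mean (m - k) + real m) / (real m + 1)"
      by (rule sum_divide_distrib[symmetric])
    also have "(\<Sum>k\<le>m. qs_mean k + qs_mean (m - k) + real m) = (\<Sum>k\<le>m. qs_mean k) + (\<Sum>k\<le>m. qs_mean (m - k)) + (real m + 1) * real m"
      by (simp add: sum.distrib)
    also have "(\<Sum>k\<le>m. qs_mean (m - k)) = (\<Sum>k\<le>m. qs_mean k)"
      by (rule sum.reindex_bij_witness[of _ "\<lambda>k. m - k" "\<lambda>k. m - k"]) auto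
    also have "(\<Sum>k\<le>m. qs_mean k) + (\<Sum>k\<le>m. qs_mean k) + (real m + 1) * real m = (real m + 1) * qs_mean (Suc m)"
      using qs_mean_recursion[of m] by (simp add: algebra_simps)
    finally show ?thesis using Suc by simp
  qed
qed

section \<open>Coupling the number of comparisons with the limit law\<close>

text \<open>If k is uniform on {0..n} and v on (0,1), then (k + v)/(n + 1) is uniform on (0,1):
  scaled by n + 1, the cells [k, k + 1) tile [0, n + 1).\<close>

lemma nn_integral_unif01_split:
  assumes [measurable]: "g \<in> borel_measurable borel"
  shows "(\<Sum>k\<le>n. \<integral>\<^sup>+v. g ((real k + v) / (real n + 1)) \<partial>unif01) / ennreal (real n + 1)
      = (\<integral>\<^sup>+u. g u \<partial>unif01)"
proof -
  define N where "N = real n + 1"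
  have N: "N > 0" by (simp add: N_def)
  \<comment> \<open>Half-open intervals let consecutive cells join without a gap; the added endpoint
    0 is null.\<close>
  have closed: "(\<integral>\<^sup>+u. f u \<partial>unif01) = (\<integral>\<^sup>+u. f u * indicator {0..<1} u \<partial>lborel)"
    if [measurable]: "f \<in> borel_measurable borel" for f :: "real \<Rightarrow> ennreal"
    unfolding nn_integral_unif01[OF that] using AE_lborel_singleton[of "0::real"]
    by (intro nn_integral_cong_AE, eventually_elim) (auto split: split_indicator)
  let ?F = "\<lambda>w. g (w / N)"
  have shift: "(\<integral>\<^sup>+v. g ((real k + v) / N) \<partial>unif01) = (\<integral>\<^sup>+w. ?F w * indicator {real k..<real k + 1} w \<partial>lborel)" for k
    by (subst closed, measurable, subst (2) nn_integral_real_affine[where c=1 and t="real k"])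
       (auto intro!: nn_integral_cong split: split_indicator)
  have sum: "(\<Sum>k<m. \<integral>\<^sup>+w. ?F w * indicator {real k..<real k + 1} w \<partial>lborel)
      = (\<integral>\<^sup>+w. ?F w * indicator {0..<real m} w \<partial>lborel)" for m
  proof (induction m)
    case (Suc m)
    have "(\<integral>\<^sup>+w. ?F w * indicator {0..<real (Suc m)} w \<partial>lborel)
        = (\<integral>\<^sup>+w. ?F w * indicator {0..<real m} w + ?F w * indicator {real m..<real m + 1} w \<partial>lborel)"
      by (intro nn_integral_cong) (auto split: split_indicator)
    also have "\<dots> = (\<integral>\<^sup>+w. ?F w * indicator {0..<real m} w \<partial>lborel)
        + (\<integral>\<^sup>+w. ?F w * indicator {real m..<real m + 1} w \<partial>lborel)"
      by (rule nn_integral_add) measurable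
    finally show ?case using Suc by simp
  qed simp
  have "(\<Sum>k\<le>n. \<integral>\<^sup>+v. g ((real k + v) / N) \<partial>unif01) = (\<integral>\<^sup>+w. ?F w * indicator {0..<N} w \<partial>lborel)"
    using sum[of "Suc n"] unfolding shift by (simp add: lessThan_Suc_atMost N_def add.commute)
  also have "\<dots> = ennreal N * (\<integral>\<^sup>+u. g u * indicator {0..<1} u \<partial>lborel)"
    using N by (subst nn_integral_real_affine[where c=N and t=0])
      (auto intro!: arg_cong2[where f="(*)"] nn_integral_cong split: split_indicator simp: mult_less_cancel_left1 zero_le_mult_iff)
  also have "\<dots> / ennreal N = (\<integral>\<^sup>+u. g u * indicator {0..<1} u \<partial>lborel)"
    using N by (subst mult.commute, subst ennreal_mult_divide_eq) auto
  finally show ?thesis by (simp add: closed N_def)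
qed

text \<open>The cross term 2 a g integrates to zero. This is the gain from centering: second moments
  of independent errors add without an extra factor.\<close>

lemma nn_integral_centered_square:
  assumes "prob_space Q" and "integrable Q g" "integrable Q (\<lambda>y. (g y)\<^sup>2)" "(\<integral>y. g y \<partial>Q) = 0"
  shows "(\<integral>\<^sup>+y. ennreal ((a + g y)\<^sup>2) \<partial>Q) = ennreal (a\<^sup>2) + (\<integral>\<^sup>+y. ennreal ((g y)\<^sup>2) \<partial>Q)"
proof -
  interpret Q: prob_space Q by fact
  have eq: "(\<lambda>y. (a + g y)\<^sup>2) = (\<lambda>y. a\<^sup>2 + (2 * a * g y + (g y)\<^sup>2))"
    by (auto simp: power2_eq_square algebra_simps)
  have int: "integrable Q (\<lambda>y. (a + g y)\<^sup>2)" unfolding eq using assms by simp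
  have "(\<integral>\<^sup>+y. ennreal ((a + g y)\<^sup>2) \<partial>Q) = ennreal (\<integral>y. (a + g y)\<^sup>2 \<partial>Q)"
    by (rule nn_integral_eq_integral[OF int]) simp
  also have "(\<integral>y. (a + g y)\<^sup>2 \<partial>Q) = a\<^sup>2 + (\<integral>y. (g y)\<^sup>2 \<partial>Q)"
    unfolding eq using assms Q.prob_space by simp
  also have "ennreal \<dots> = ennreal (a\<^sup>2) + ennreal (\<integral>y. (g y)\<^sup>2 \<partial>Q)"
    by (rule ennreal_plus) auto
  also have "ennreal (\<integral>y. (g y)\<^sup>2 \<partial>Q) = (\<integral>\<^sup>+y. ennreal ((g y)\<^sup>2) \<partial>Q)"
    by (rule nn_integral_eq_integral[symmetric]) (use assms in auto)
  finally show ?thesis .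
qed

section \<open>The recursive coupling and its marginals\<close>

definition combine :: "nat \<Rightarrow> nat \<Rightarrow> real \<Rightarrow> real \<times> real \<Rightarrow> real \<times> real \<Rightarrow> real \<times> real" where
  "combine n k v w w' = (fst w + fst w' + real n, mix (snd w) (snd w') ((real k + v) / (real n + 1)))"

abbreviation borel2 :: "(real \<times> real) measure" where
  "borel2 \<equiv> borel \<Otimes>\<^sub>M borel"

lemma combine_measurable [measurable (raw)]:
  assumes [measurable]: "f \<in> borel_measurable N" "g \<in> measurable N borel2" "h \<in> measurable N borel2"
  shows "(\<lambda>x. combine n k (f x) (g x) (h x)) \<in> measurable N borel2"
  unfolding combine_def by measurable

context quicksort_limit
begin

text \<open>Both components are driven by the same k: the count splits into k and n - k while the
  limit variable uses u = (k + v)/(n + 1), so both split at nearly the same ratio. Writing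
  \<open>min k n\<close> instead of k makes the recursive call visibly smaller without knowing that
  the drawn k is at most n.\<close>

fun coupling :: "nat \<Rightarrow> (real \<times> real) measure" where
  "coupling 0 = distr M borel2 (\<lambda>y. (0, y))"
| "coupling (Suc n) = Giry_Monad.bind (measure_pmf (pmf_of_set {..n}))
     (\<lambda>k. distr (unif01 \<Otimes>\<^sub>M (coupling (min k n) \<Otimes>\<^sub>M coupling (n - k))) borel2
       (\<lambda>w. combine n k (fst w) (fst (snd w)) (snd (snd w))))"

lemma coupling_sets_prob: "sets (coupling n) = sets borel2 \<and> prob_space (coupling n)"
proof (induction n rule: less_induct)
  case (less n)
  show ?case
  proof (cases n)
    case 0
    then show ?thesis by (auto intro!: prob_space_distr)
  next
    case (Suc m)
    let ?K = "\<lambda>k. distr (unif01 \<Otimes>\<^sub>M (coupling (min k m) \<Otimes>\<^sub>M coupling (m - k))) borel2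
       (\<lambda>w. combine m k (fst w) (fst (snd w)) (snd (snd w)))"
    have p: "prob_space (?K k)" for k
    proof -
      have ps: "prob_space (coupling (min k m))" "prob_space (coupling (m - k))"
        and [measurable_cong]: "sets (coupling (min k m)) = sets borel2" "sets (coupling (m - k)) = sets borel2"
        using less Suc by auto
      interpret A: prob_space "coupling (min k m)" by fact
      interpret B: prob_space "coupling (m - k)" by fact
      interpret AB: pair_prob_space "coupling (min k m)" "coupling (m - k)" ..
      interpret UAB: pair_prob_space unif01 "coupling (min k m) \<Otimes>\<^sub>M coupling (m - k)" ..
      show ?thesis by (rule UAB.prob_space_distr) measurable
    qed
    have "?K \<in> measure_pmf (pmf_of_set {..m}) \<rightarrow>\<^sub>M subprob_algebra borel2"
      using p by (auto simp: space_subprob_algebra intro: prob_space_imp_subprob_space)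
    then show ?thesis using p Suc
      by (auto intro!: sets_bind measure_pmf.prob_space_bind simp del: sets_pair_measure_cong)
  qed
qed

lemma sets_coupling [measurable_cong]: "sets (coupling n) = sets borel2"
  using coupling_sets_prob by blast

lemma prob_space_coupling: "prob_space (coupling n)"
  using coupling_sets_prob by blast

lemma nn_integral_coupling_Suc:
  assumes [measurable]: "f \<in> borel_measurable borel2"
  shows "(\<integral>\<^sup>+w. f w \<partial>coupling (Suc n)) =
    (\<Sum>k\<le>n. \<integral>\<^sup>+v. \<integral>\<^sup>+w. \<integral>\<^sup>+w'. f (combine n k v w w') \<partial>coupling (n - k) \<partial>coupling k \<partial>unif01) / ennreal (real n + 1)"
proof -
  let ?K = "\<lambda>k. distr (unif01 \<Otimes>\<^sub>M (coupling (min k n) \<Otimes>\<^sub>M coupling (n - k))) borel2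
       (\<lambda>w. combine n k (fst w) (fst (snd w)) (snd (snd w)))"
  have p: "prob_space (?K k) \<and> (\<integral>\<^sup>+w. f w \<partial>?K k) =
      (\<integral>\<^sup>+v. \<integral>\<^sup>+w. \<integral>\<^sup>+w'. f (combine n k v w w') \<partial>coupling (n - k) \<partial>coupling (min k n) \<partial>unif01)" for k
  proof -
    interpret A: prob_space "coupling (min k n)" by (rule prob_space_coupling)
    interpret B: prob_space "coupling (n - k)" by (rule prob_space_coupling)
    interpret AB: pair_prob_space "coupling (min k n)" "coupling (n - k)" ..
    interpret UAB: pair_prob_space unif01 "coupling (min k n) \<Otimes>\<^sub>M coupling (n - k)" ..
    have "(\<integral>\<^sup>+w. f w \<partial>?K k) = (\<integral>\<^sup>+w. f (combine n k (fst w) (fst (snd w)) (snd (snd w)))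
        \<partial>(unif01 \<Otimes>\<^sub>M (coupling (min k n) \<Otimes>\<^sub>M coupling (n - k))))"
      by (rule nn_integral_distr) measurable
    also have "\<dots> = (\<integral>\<^sup>+v. \<integral>\<^sup>+w. f (combine n k v (fst w) (snd w)) \<partial>(coupling (min k n) \<Otimes>\<^sub>M coupling (n - k)) \<partial>unif01)"
      by (subst AB.nn_integral_fst[symmetric]) auto
    also have "\<dots> = (\<integral>\<^sup>+v. \<integral>\<^sup>+w. \<integral>\<^sup>+w'. f (combine n k v w w') \<partial>coupling (n - k) \<partial>coupling (min k n) \<partial>unif01)"
      by (intro nn_integral_cong, subst B.nn_integral_fst[symmetric]) auto
    finally show ?thesis by (auto intro: UAB.prob_space_distr)
  qed
  have K: "?K \<in> measure_pmf (pmf_of_set {..n}) \<rightarrow>\<^sub>M subprob_algebra borel2"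
    using p by (auto simp: space_subprob_algebra intro: prob_space_imp_subprob_space)
  have "(\<integral>\<^sup>+w. f w \<partial>coupling (Suc n)) = (\<integral>\<^sup>+k. \<integral>\<^sup>+w. f w \<partial>?K k \<partial>measure_pmf (pmf_of_set {..n}))"
    unfolding coupling.simps by (rule nn_integral_bind[OF _ K]) measurable
  also have "\<dots> = (\<Sum>k\<le>n. \<integral>\<^sup>+w. f w \<partial>?K k) / ennreal (real n + 1)"
    by (subst nn_integral_pmf_of_set) (auto simp: ennreal_of_nat_eq_real_of_nat add.commute)
  also have "(\<Sum>k\<le>n. \<integral>\<^sup>+w. f w \<partial>?K k) =
      (\<Sum>k\<le>n. \<integral>\<^sup>+v. \<integral>\<^sup>+w. \<integral>\<^sup>+w'. f (combine n k v w w') \<partial>coupling (n - k) \<partial>coupling k \<partial>unif01)"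
  proof (intro sum.cong refl)
    fix k assume "k \<in> {..n}"
    then have "min k n = k" by simp
    then show "(\<integral>\<^sup>+w. f w \<partial>?K k) = (\<integral>\<^sup>+v. \<integral>\<^sup>+w. \<integral>\<^sup>+w'. f (combine n k v w w') \<partial>coupling (n - k) \<partial>coupling k \<partial>unif01)"
      using conjunct2[OF p, of k] by (simp only:)
  qed
  finally show ?thesis .
qed

text \<open>Induction with f arbitrary, because the hypothesis is applied twice to partly evaluated
  functions: first to w' with w fixed, then to the function of \<open>fst w\<close> that remains.
  The first component does not depend on v.\<close>

lemma nn_integral_coupling_fst:
  assumes [measurable]: "f \<in> borel_measurable borel"
  shows "(\<integral>\<^sup>+w. f (fst w) \<partial>coupling n) = (\<integral>\<^sup>+x. f (real x) \<partial>measure_pmf (qs_comparisons n))"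
  using assms
proof (induction n arbitrary: f rule: less_induct)
  case (less n)
  note [measurable] = less.prems
  show ?case
  proof (cases n)
    case 0
    then show ?thesis using emeasure_space_1 by (simp add: nn_integral_distr)
  next
    case (Suc m)
    have pair: "(\<integral>\<^sup>+v. \<integral>\<^sup>+w. \<integral>\<^sup>+w'. f (fst (combine m k v w w')) \<partial>coupling (m - k) \<partial>coupling k \<partial>unif01)
        = (\<integral>\<^sup>+x. f (real x) \<partial>measure_pmf (map_pmf (\<lambda>(a, b). a + b + m) (pair_pmf (qs_comparisons k) (qs_comparisons (m - k)))))"
      if "k \<le> m" for k
    proof -
      have "(\<integral>\<^sup>+w. \<integral>\<^sup>+w'. f (fst w + fst w' + real m) \<partial>coupling (m - k) \<partial>coupling k)
          = (\<integral>\<^sup>+w. \<integral>\<^sup>+b. f (fst w + real b + real m) \<partial>measure_pmf (qs_comparisons (m - k)) \<partial>coupling k)"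
        using less.IH[of "m - k" "\<lambda>x. f (_ + x + real m)"] Suc by (intro nn_integral_cong) auto
      also have "\<dots> = (\<integral>\<^sup>+a. \<integral>\<^sup>+b. f (real a + real b + real m) \<partial>measure_pmf (qs_comparisons (m - k)) \<partial>measure_pmf (qs_comparisons k))"
      proof (rule less.IH[of k "\<lambda>x. \<integral>\<^sup>+b. f (x + real b + real m) \<partial>measure_pmf (qs_comparisons (m - k))"])
        show "(\<lambda>x. \<integral>\<^sup>+b. f (x + real b + real m) \<partial>measure_pmf (qs_comparisons (m - k))) \<in> borel_measurable borel"
          by (subst nn_integral_measure_pmf_finite) auto
      qed (use that Suc in auto)
      also have "\<dots> = (\<integral>\<^sup>+x. f (real x) \<partial>measure_pmf (map_pmf (\<lambda>(a, b). a + b + m) (pair_pmf (qs_comparisons k) (qs_comparisons (m - k)))))"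
        by (simp add: nn_integral_pair_pmf' split_beta')
      finally show ?thesis using U.emeasure_space_1 by (simp add: combine_def)
    qed
    have "(\<integral>\<^sup>+w. f (fst w) \<partial>coupling n) = (\<Sum>k\<le>m. \<integral>\<^sup>+v. \<integral>\<^sup>+w. \<integral>\<^sup>+w'. f (fst (combine m k v w w')) \<partial>coupling (m - k) \<partial>coupling k \<partial>unif01) / ennreal (real m + 1)"
      unfolding Suc by (rule nn_integral_coupling_Suc) measurable
    also have "\<dots> = (\<Sum>k\<le>m. \<integral>\<^sup>+x. f (real x) \<partial>measure_pmf (map_pmf (\<lambda>(a, b). a + b + m) (pair_pmf (qs_comparisons k) (qs_comparisons (m - k))))) / ennreal (real m + 1)"
      using pair by simp
    also have "\<dots> = (\<integral>\<^sup>+x. f (real x) \<partial>measure_pmf (qs_comparisons n))"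
      unfolding Suc qs_comparisons_Suc nn_integral_bind_pmf
      by (subst nn_integral_pmf_of_set) (auto simp: ennreal_of_nat_eq_real_of_nat add.commute)
    finally show ?thesis .
  qed
qed

lemma nn_integral_fixed_point:
  assumes [measurable]: "f \<in> borel_measurable borel"
  shows "(\<integral>\<^sup>+y. f y \<partial>M) = (\<integral>\<^sup>+u. \<integral>\<^sup>+y. \<integral>\<^sup>+z. f (mix y z u) \<partial>M \<partial>M \<partial>unif01)"
proof -
  have "(\<integral>\<^sup>+y. f y \<partial>M) = (\<integral>\<^sup>+w. f (mix (fst (snd w)) (snd (snd w)) (fst w)) \<partial>(unif01 \<Otimes>\<^sub>M (M \<Otimes>\<^sub>M M)))"
    by (subst (1) fixed_point[symmetric], rule nn_integral_distr) measurable
  also have "\<dots> = (\<integral>\<^sup>+u. \<integral>\<^sup>+w. f (mix (fst w) (snd w) u) \<partial>(M \<Otimes>\<^sub>M M) \<partial>unif01)"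
    by (subst MM.nn_integral_fst[symmetric]) auto
  also have "\<dots> = (\<integral>\<^sup>+u. \<integral>\<^sup>+y. \<integral>\<^sup>+z. f (mix y z u) \<partial>M \<partial>M \<partial>unif01)"
    by (intro nn_integral_cong, subst nn_integral_fst[symmetric]) auto
  finally show ?thesis .
qed

text \<open>The subproblems contribute independent draws from M; averaging over k and v makes u
  uniform by \<open>nn_integral_unif01_split\<close>, and the fixed-point equation closes the
  induction.\<close>

lemma nn_integral_coupling_snd:
  assumes [measurable]: "f \<in> borel_measurable borel"
  shows "(\<integral>\<^sup>+w. f (snd w) \<partial>coupling n) = (\<integral>\<^sup>+y. f y \<partial>M)"
  using assms
proof (induction n arbitrary: f rule: less_induct)
  case (less n)
  note [measurable] = less.prems
  show ?case
  proof (cases n)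
    case 0
    then show ?thesis by (simp add: nn_integral_distr)
  next
    case (Suc m)
    have pair: "(\<integral>\<^sup>+w. \<integral>\<^sup>+w'. f (snd (combine m k v w w')) \<partial>coupling (m - k) \<partial>coupling k)
        = (\<integral>\<^sup>+y. \<integral>\<^sup>+z. f (mix y z ((real k + v) / (real m + 1))) \<partial>M \<partial>M)" if "k \<le> m" for k v
    proof -
      let ?u = "(real k + v) / (real m + 1)"
      have "(\<integral>\<^sup>+w. \<integral>\<^sup>+w'. f (mix (snd w) (snd w') ?u) \<partial>coupling (m - k) \<partial>coupling k)
          = (\<integral>\<^sup>+w. \<integral>\<^sup>+z. f (mix (snd w) z ?u) \<partial>M \<partial>coupling k)"
        using less.IH[of "m - k" "\<lambda>z. f (mix _ z ?u)"] Suc by (intro nn_integral_cong) auto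
      also have "\<dots> = (\<integral>\<^sup>+y. \<integral>\<^sup>+z. f (mix y z ?u) \<partial>M \<partial>M)"
        using that Suc by (intro less.IH[of k "\<lambda>y. \<integral>\<^sup>+z. f (mix y z ?u) \<partial>M"]) auto
      finally show ?thesis by (simp add: combine_def)
    qed
    have "(\<integral>\<^sup>+w. f (snd w) \<partial>coupling n) = (\<Sum>k\<le>m. \<integral>\<^sup>+v. \<integral>\<^sup>+w. \<integral>\<^sup>+w'. f (snd (combine m k v w w')) \<partial>coupling (m - k) \<partial>coupling k \<partial>unif01) / ennreal (real m + 1)"
      unfolding Suc by (rule nn_integral_coupling_Suc) measurable
    also have "\<dots> = (\<Sum>k\<le>m. \<integral>\<^sup>+v. \<integral>\<^sup>+y. \<integral>\<^sup>+z. f (mix y z ((real k + v) / (real m + 1))) \<partial>M \<partial>M \<partial>unif01) / ennreal (real m + 1)"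
      using pair by simp
    also have "\<dots> = (\<integral>\<^sup>+u. \<integral>\<^sup>+y. \<integral>\<^sup>+z. f (mix y z u) \<partial>M \<partial>M \<partial>unif01)"
      by (rule nn_integral_unif01_split) measurable
    also have "\<dots> = (\<integral>\<^sup>+y. f y \<partial>M)"
      by (rule nn_integral_fixed_point[symmetric]) measurable
    finally show ?thesis .
  qed
qed

lemma distr_coupling_fst: "distr (coupling n) borel fst = distr (measure_pmf (qs_comparisons n)) borel real"
proof (rule measure_eqI)
  fix A assume "A \<in> sets (distr (coupling n) borel fst)"
  then have [measurable]: "A \<in> sets borel" by simp
  have "emeasure (distr (coupling n) borel fst) A = (\<integral>\<^sup>+x. indicator A x \<partial>distr (coupling n) borel fst)"
    by simp
  also have "\<dots> = (\<integral>\<^sup>+w. indicator A (fst w) \<partial>coupling n)"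
    by (rule nn_integral_distr) measurable
  also have "\<dots> = (\<integral>\<^sup>+x. indicator A (real x) \<partial>measure_pmf (qs_comparisons n))"
    by (rule nn_integral_coupling_fst) measurable
  also have "\<dots> = (\<integral>\<^sup>+x. indicator A x \<partial>distr (measure_pmf (qs_comparisons n)) borel real)"
    by (rule nn_integral_distr[symmetric]) measurable
  finally show "emeasure (distr (coupling n) borel fst) A = emeasure (distr (measure_pmf (qs_comparisons n)) borel real) A"
    by simp
qed simp

lemma distr_coupling_snd: "distr (coupling n) borel snd = M"
proof (rule measure_eqI)
  fix A assume "A \<in> sets (distr (coupling n) borel snd)"
  then have [measurable]: "A \<in> sets borel" by simp
  have "emeasure (distr (coupling n) borel snd) A = (\<integral>\<^sup>+x. indicator A x \<partial>distr (coupling n) borel snd)"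
    by simp
  also have "\<dots> = (\<integral>\<^sup>+w. indicator A (snd w) \<partial>coupling n)"
    by (rule nn_integral_distr) measurable
  also have "\<dots> = (\<integral>\<^sup>+x. indicator A x \<partial>M)"
    by (rule nn_integral_coupling_snd) measurable
  finally show "emeasure (distr (coupling n) borel snd) A = emeasure M A"
    by simp
qed simp

text \<open>For n >= 1 this is n (Y_n - c Y), the error before normalization by n.\<close>

definition diff :: "real \<Rightarrow> nat \<Rightarrow> real \<times> real \<Rightarrow> real" where
  "diff c n w = fst w - qs_mean n - c * real n * snd w"

lemma diff_measurable [measurable]: "diff c n \<in> borel_measurable borel2"
  unfolding diff_def[abs_def] by measurable

lemma integrable_coupling_fst: "integrable (coupling n) fst" "integrable (coupling n) (\<lambda>w. (fst w)\<^sup>2)"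
  "(\<integral>w. fst w \<partial>coupling n) = qs_mean n"
proof -
  have i: "integrable (distr (coupling n) borel fst) f" if [measurable]: "f \<in> borel_measurable borel" for f :: "real \<Rightarrow> real"
    unfolding distr_coupling_fst by (subst integrable_distr_eq) (auto intro: integrable_measure_pmf_finite)
  show "integrable (coupling n) fst" "integrable (coupling n) (\<lambda>w. (fst w)\<^sup>2)"
    using i[of "\<lambda>x. x"] i[of "\<lambda>x. x\<^sup>2"] by (auto simp: integrable_distr_eq)
  have "(\<integral>w. fst w \<partial>coupling n) = (\<integral>x. x \<partial>distr (coupling n) borel fst)"
    by (subst integral_distr) auto
  also have "\<dots> = qs_mean n"
    unfolding distr_coupling_fst by (subst integral_distr) (auto simp: expectation_qs_comparisons)
  finally show "(\<integral>w. fst w \<partial>coupling n) = qs_mean n" .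
qed

lemma integrable_coupling_snd: "integrable (coupling n) snd" "integrable (coupling n) (\<lambda>w. (snd w)\<^sup>2)"
  "(\<integral>w. snd w \<partial>coupling n) = 0"
proof -
  have M: "integrable M (\<lambda>x. x)" "integrable M (\<lambda>x. x\<^sup>2)" "(\<integral>x. x \<partial>M) = 0"
    using limit_law by (auto simp: is_quicksort_limit_law_def)
  have "integrable (distr (coupling n) borel snd) (\<lambda>x. x)" "integrable (distr (coupling n) borel snd) (\<lambda>x. x\<^sup>2)"
    using M(1,2) unfolding distr_coupling_snd .
  then show "integrable (coupling n) snd" "integrable (coupling n) (\<lambda>w. (snd w)\<^sup>2)"
    by (auto simp: integrable_distr_eq)
  have "(\<integral>w. snd w \<partial>coupling n) = (\<integral>x. x \<partial>distr (coupling n) borel snd)"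
    by (subst integral_distr) auto
  then show "(\<integral>w. snd w \<partial>coupling n) = 0"
    unfolding distr_coupling_snd M(3) .
qed

lemma diff_centered: "integrable (coupling n) (diff c n)" "integrable (coupling n) (\<lambda>w. (diff c n w)\<^sup>2)"
  "(\<integral>w. diff c n w \<partial>coupling n) = 0"
proof -
  interpret C: prob_space "coupling n" by (rule prob_space_coupling)
  note i = integrable_coupling_fst[of n] integrable_coupling_snd[of n]
  show "integrable (coupling n) (diff c n)" "(\<integral>w. diff c n w \<partial>coupling n) = 0"
    unfolding diff_def[abs_def] using i C.prob_space by auto
  show "integrable (coupling n) (\<lambda>w. (diff c n w)\<^sup>2)"
  proof (rule Bochner_Integration.integrable_bound)
    show "integrable (coupling n) (\<lambda>w. 3 * (fst w)\<^sup>2 + 3 * (qs_mean n)\<^sup>2 + 3 * (c * real n)\<^sup>2 * (snd w)\<^sup>2)"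
      using i by auto
    \<comment> \<open>The difference of the two sides is (x + y)^2 + (x + z)^2 + (y - z)^2.\<close>
    have "(x - y - z)\<^sup>2 \<le> 3 * x\<^sup>2 + 3 * y\<^sup>2 + 3 * z\<^sup>2" for x y z :: real
      using zero_le_power2[of "x + y"] zero_le_power2[of "x + z"] zero_le_power2[of "y - z"]
      by (simp add: power2_eq_square algebra_simps)
    from this[of "fst _" "qs_mean n" "c * real n * snd _"]
    show "AE w in coupling n. norm ((diff c n w)\<^sup>2) \<le> norm (3 * (fst w)\<^sup>2 + 3 * (qs_mean n)\<^sup>2 + 3 * (c * real n)\<^sup>2 * (snd w)\<^sup>2)"
      by (intro AE_I2) (simp add: diff_def power_mult_distrib mult.assoc)
  qed measurable
qed

end

section \<open>Moments of the coupling error\<close>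

lemma power_add3_le:
  fixes a b d :: real
  assumes "0 \<le> a" "0 \<le> b" "0 \<le> d"
  shows "(a + b + d) ^ q \<le> 3 ^ q * (a ^ q + b ^ q + d ^ q)"
proof -
  define m where "m = max a (max b d)"
  have "(a + b + d) ^ q \<le> (3 * m) ^ q" using assms by (intro power_mono) (auto simp: m_def)
  also have "\<dots> = 3 ^ q * m ^ q" by (rule power_mult_distrib)
  also have "m ^ q \<le> a ^ q + b ^ q + d ^ q" using assms by (auto simp: m_def max_def)
  finally show ?thesis by simp
qed

lemma ennreal_mult_plus:
  "\<lbrakk>0 \<le> t; 0 \<le> a; 0 \<le> b\<rbrakk> \<Longrightarrow> ennreal (t * (a + b)) = ennreal t * (ennreal a + ennreal b)"
  by (simp only: ennreal_mult' ennreal_plus)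

context quicksort_limit
begin

definition moment :: "real \<Rightarrow> nat \<Rightarrow> nat \<Rightarrow> ennreal" where
  "moment c q n = (\<integral>\<^sup>+w. ennreal (\<bar>diff c n w\<bar> ^ q) \<partial>coupling n)"

text \<open>What the recursion adds to the errors of the two subproblems. Since (n + 1) u = k + v
  and (n + 1) (1 - u) = (n - k) + (1 - v), the weights of the two limit variables exceed the
  subproblem sizes by v and 1 - v; the rest is the toll discrepancy.\<close>

definition noise :: "real \<Rightarrow> nat \<Rightarrow> nat \<Rightarrow> real \<Rightarrow> real \<times> real \<Rightarrow> real \<times> real \<Rightarrow> real" where
  "noise c n k v w w' = split_cost n k - c * ((real n + 1) * toll ((real k + v) / (real n + 1)))
     - v * (c * snd w) - (1 - v) * (c * snd w')"

lemma noise_measurable [measurable (raw)]: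
  assumes [measurable]: "f \<in> borel_measurable N" "(\<lambda>x. snd (g x)) \<in> borel_measurable N"
    "(\<lambda>x. snd (h x)) \<in> borel_measurable N"
  shows "(\<lambda>x. noise c n k (f x) (g x) (h x)) \<in> borel_measurable N"
  unfolding noise_def by measurable

lemma diff_combine:
  assumes "k \<le> n"
  shows "diff c (Suc n) (combine n k v w w') = (diff c k w + diff c (n - k) w') + noise c n k v w w'"
proof -
  define u where "u = (real k + v) / (real n + 1)"
  have u: "(real n + 1) * u = real k + v" by (simp add: u_def)
  have nk: "real (n - k) = real n - real k" using assms by (simp add: of_nat_diff)
  have "c * (real n + 1) * mix (snd w) (snd w') u
      = c * ((real n + 1) * u) * snd w + c * (real n + 1 - (real n + 1) * u) * snd w' + c * ((real n + 1) * toll u)"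
    by (simp add: mix_def algebra_simps)
  then have m: "c * (real n + 1) * mix (snd w) (snd w') u
      = c * (real k + v) * snd w + c * (real n + 1 - (real k + v)) * snd w' + c * ((real n + 1) * toll u)"
    by (simp only: u)
  have "diff c (Suc n) (combine n k v w w')
      = fst w + fst w' + real n - qs_mean (Suc n) - c * (real n + 1) * mix (snd w) (snd w') u"
    by (simp add: diff_def combine_def u_def add.commute)
  then show ?thesis
    unfolding m noise_def diff_def split_cost_def u_def[symmetric] nk by (simp add: algebra_simps)
qed

end

text \<open>The weight \<open>c = 0\<close> gives the moments of \<open>X\<^sub>n - \<mu>\<^sub>n\<close> itself (with \<open>\<alpha> = 1\<close>), from which the moments of
  the limit law are obtained; \<open>c = 1\<close> gives the coupling error.\<close>

locale quicksort_comparison = quicksort_limit +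
  fixes c \<alpha> G :: real
  assumes \<alpha>: "1/2 < \<alpha>" and G: "0 \<le> G"
    and cost: "\<And>n k v. \<lbrakk>k \<le> n; 0 < v; v < 1\<rbrakk> \<Longrightarrow>
      \<bar>split_cost n k - c * ((real n + 1) * toll ((real k + v) / (real n + 1)))\<bar> \<le> G * (real n + 2) powr \<alpha>"
begin

text \<open>The toll discrepancy is bounded by \<open>cost\<close>, and v and 1 - v are at most 1,
  so the noise is at most two terms distributed as |c Y| plus G (n + 2)^\<alpha>, uniformly in
  v.\<close>

lemma noise_moment:
  assumes "q > 0" "B \<ge> 0" and M_moment: "(\<integral>\<^sup>+y. ennreal (\<bar>c * y\<bar> ^ q) \<partial>M) \<le> ennreal B"
    and "k \<le> n" "0 < v" "v < 1"
  shows "(\<integral>\<^sup>+w. \<integral>\<^sup>+w'. ennreal (\<bar>noise c n k v w w'\<bar> ^ q) \<partial>coupling (n - k) \<partial>coupling k)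
    \<le> ennreal (3 ^ q * (2 * B + G ^ q) * (real n + 2) powr (\<alpha> * real q))"
proof -
  interpret A: prob_space "coupling k" by (rule prob_space_coupling)
  interpret B: prob_space "coupling (n - k)" by (rule prob_space_coupling)
  let ?\<tau> = "G ^ q * (real n + 2) powr (\<alpha> * real q)"
  let ?m = "\<lambda>w::real \<times> real. ennreal (\<bar>c * snd w\<bar> ^ q)"
  have powr_eq: "(G * (real n + 2) powr \<alpha>) ^ q = ?\<tau>"
    by (simp add: power_mult_distrib powr_powr[symmetric] powr_realpow)
  have pointwise: "\<bar>noise c n k v w w'\<bar> ^ q \<le> 3 ^ q * (\<bar>c * snd w\<bar> ^ q + \<bar>c * snd w'\<bar> ^ q + ?\<tau>)" for w w'
  proof -
    have "\<bar>v * (c * snd w)\<bar> \<le> \<bar>c * snd w\<bar>" "\<bar>(1 - v) * (c * snd w')\<bar> \<le> \<bar>c * snd w'\<bar>"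
      using assms by (auto simp: abs_mult[of v] abs_mult[of "1 - v"] intro!: mult_left_le_one_le)
    then have "\<bar>noise c n k v w w'\<bar> \<le> \<bar>c * snd w\<bar> + \<bar>c * snd w'\<bar> + G * (real n + 2) powr \<alpha>"
      using cost[OF assms(4-6)] unfolding noise_def by linarith
    then have "\<bar>noise c n k v w w'\<bar> ^ q \<le> (\<bar>c * snd w\<bar> + \<bar>c * snd w'\<bar> + G * (real n + 2) powr \<alpha>) ^ q"
      by (intro power_mono) auto
    also have "\<dots> \<le> 3 ^ q * (\<bar>c * snd w\<bar> ^ q + \<bar>c * snd w'\<bar> ^ q + (G * (real n + 2) powr \<alpha>) ^ q)"
      using G by (intro power_add3_le) auto
    finally show ?thesis unfolding powr_eq .
  qed
  have M_le: "(\<integral>\<^sup>+w. ?m w \<partial>coupling j) \<le> ennreal B" for j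
    using nn_integral_coupling_snd[of "\<lambda>y. ennreal (\<bar>c * y\<bar> ^ q)" j] M_moment by simp
  have \<tau>: "?\<tau> \<ge> 0" using G by simp
  have "(\<integral>\<^sup>+w. \<integral>\<^sup>+w'. ennreal (\<bar>noise c n k v w w'\<bar> ^ q) \<partial>coupling (n - k) \<partial>coupling k)
      \<le> (\<integral>\<^sup>+w. \<integral>\<^sup>+w'. ennreal (3 ^ q) * (?m w + (?m w' + ennreal ?\<tau>)) \<partial>coupling (n - k) \<partial>coupling k)"
  proof (intro nn_integral_mono)
    fix w w'
    have "ennreal (\<bar>noise c n k v w w'\<bar> ^ q) \<le> ennreal (3 ^ q * (\<bar>c * snd w\<bar> ^ q + (\<bar>c * snd w'\<bar> ^ q + ?\<tau>)))"
      using pointwise[of w w'] by (intro ennreal_leI) (simp add: add.assoc)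
    also have "\<dots> = ennreal (3 ^ q) * (?m w + (?m w' + ennreal ?\<tau>))"
      using \<tau> by (subst ennreal_mult_plus) auto
    finally show "ennreal (\<bar>noise c n k v w w'\<bar> ^ q) \<le> ennreal (3 ^ q) * (?m w + (?m w' + ennreal ?\<tau>))" .
  qed
  also have "\<dots> = ennreal (3 ^ q) * ((\<integral>\<^sup>+w. ?m w \<partial>coupling k) + ((\<integral>\<^sup>+w. ?m w \<partial>coupling (n - k)) + ennreal ?\<tau>))"
    by (simp add: nn_integral_cmult nn_integral_add A.emeasure_space_1 B.emeasure_space_1)
  also have "\<dots> \<le> ennreal (3 ^ q) * (ennreal B + (ennreal B + ennreal ?\<tau>))"
    by (intro mult_left_mono add_mono M_le order_refl) auto
  also have "\<dots> = ennreal (3 ^ q * (B + (B + ?\<tau>)))"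
    using \<tau> assms by (subst ennreal_mult_plus) auto
  also have "\<dots> \<le> ennreal (3 ^ q * (2 * B + G ^ q) * (real n + 2) powr (\<alpha> * real q))"
  proof (rule ennreal_leI)
    have "1 \<le> (real n + 2) powr (\<alpha> * real q)"
      using \<alpha> by (intro ge_one_powr_ge_zero) auto
    then have "2 * B \<le> 2 * B * (real n + 2) powr (\<alpha> * real q)"
      using \<open>B \<ge> 0\<close> by (simp add: mult_le_cancel_left1)
    then have "3 ^ q * (B + (B + ?\<tau>)) \<le> 3 ^ q * (2 * B * (real n + 2) powr (\<alpha> * real q) + ?\<tau>)"
      by (intro mult_left_mono) auto
    then show "3 ^ q * (B + (B + ?\<tau>)) \<le> 3 ^ q * (2 * B + G ^ q) * (real n + 2) powr (\<alpha> * real q)"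
      by (simp add: algebra_simps)
  qed
  finally show ?thesis .
qed

text \<open>Separates the noise from the sum of the subproblem errors at the cost of a factor 1 +
  \<delta>, so that only the moments of that sum remain to be estimated, in \<open>pair\<close>.
  Since 2 \<theta> is strictly below \<alpha> q + 1, a small \<delta> keeps the recursion
  contracting.\<close>

lemma moment_recursion:
  assumes "q > 0" "B \<ge> 0" and M_moment: "(\<integral>\<^sup>+y. ennreal (\<bar>c * y\<bar> ^ q) \<partial>M) \<le> ennreal B"
    and "\<theta> \<ge> 0" "C \<ge> 0" "1 \<le> \<alpha> * real q" "2 * \<theta> < \<alpha> * real q + 1"
    and pair: "\<And>n k. k \<le> n \<Longrightarrow>
      (\<integral>\<^sup>+w. \<integral>\<^sup>+w'. ennreal (\<bar>diff c k w + diff c (n - k) w'\<bar> ^ q) \<partial>coupling (n - k) \<partial>coupling k)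
      \<le> ennreal \<theta> * (moment c q k + moment c q (n - k)) + ennreal (C * (real n + 2) powr (\<alpha> * real q))"
  obtains K where "K \<ge> 0" "\<And>n. moment c q n \<le> ennreal (K * (real n + 1) powr (\<alpha> * real q))"
proof -
  define s where "s = \<alpha> * real q"
  \<comment> \<open>The denominator exceeds 2 \<theta>, so 2 \<theta> \<delta> stays below the gap s
    + 1 - 2 \<theta>; it is positive even for \<theta> = 0.\<close>
  define \<delta> where "\<delta> = (s + 1 - 2 * \<theta>) / (2 * \<theta> + 1)"
  have \<delta>: "\<delta> > 0" using assms by (auto simp: \<delta>_def s_def intro!: divide_pos_pos)
  have "2 * \<theta> * \<delta> < s + 1 - 2 * \<theta>"
  proof -
    have "2 * \<theta> * \<delta> < (2 * \<theta> + 1) * \<delta>" using \<delta> by simp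
    also have "\<dots> = s + 1 - 2 * \<theta>" using assms(4) by (simp add: \<delta>_def)
    finally show ?thesis .
  qed
  then have \<theta>': "2 * ((1 + \<delta>) * \<theta>) < s + 1" by (simp add: algebra_simps)
  obtain D where D: "D \<ge> 0" "\<And>x y. \<lbrakk>0 \<le> x; 0 \<le> y\<rbrakk> \<Longrightarrow> (x + y) ^ q \<le> (1 + \<delta>) * x ^ q + D * y ^ q"
    using power_add_le_split[OF \<delta> \<open>q > 0\<close>] by blast
  define R where "R = (1 + \<delta>) * C + D * (3 ^ q * (2 * B + G ^ q))"
  have R: "R \<ge> 0" using \<delta> D assms G by (simp add: R_def)
  let ?I = "\<lambda>n k. \<integral>\<^sup>+v. \<integral>\<^sup>+w. \<integral>\<^sup>+w'. ennreal (\<bar>diff c (Suc n) (combine n k v w w')\<bar> ^ q) \<partial>coupling (n - k) \<partial>coupling k \<partial>unif01"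
  have I: "?I n k \<le> ennreal ((1 + \<delta>) * \<theta>) * (moment c q k + moment c q (n - k)) + ennreal (R * (real n + 2) powr s)"
    if kn: "k \<le> n" for n k
  proof -
    interpret A: prob_space "coupling k" by (rule prob_space_coupling)
    interpret B: prob_space "coupling (n - k)" by (rule prob_space_coupling)
    have inner: "(\<integral>\<^sup>+w. \<integral>\<^sup>+w'. ennreal (\<bar>diff c (Suc n) (combine n k v w w')\<bar> ^ q) \<partial>coupling (n - k) \<partial>coupling k)
        \<le> ennreal ((1 + \<delta>) * \<theta>) * (moment c q k + moment c q (n - k)) + ennreal (R * (real n + 2) powr s)"
      if v: "0 < v" "v < 1" for v
    proof -
      let ?X = "\<lambda>w w'. diff c k w + diff c (n - k) w'"
      have "(\<integral>\<^sup>+w. \<integral>\<^sup>+w'. ennreal (\<bar>diff c (Suc n) (combine n k v w w')\<bar> ^ q) \<partial>coupling (n - k) \<partial>coupling k)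
          \<le> (\<integral>\<^sup>+w. \<integral>\<^sup>+w'. ennreal (1 + \<delta>) * ennreal (\<bar>?X w w'\<bar> ^ q) + ennreal D * ennreal (\<bar>noise c n k v w w'\<bar> ^ q)
              \<partial>coupling (n - k) \<partial>coupling k)"
      proof (intro nn_integral_mono)
        fix w w'
        have "\<bar>diff c (Suc n) (combine n k v w w')\<bar> ^ q \<le> (\<bar>?X w w'\<bar> + \<bar>noise c n k v w w'\<bar>) ^ q"
          unfolding diff_combine[OF kn] by (intro power_mono abs_triangle_ineq) auto
        also have "\<dots> \<le> (1 + \<delta>) * \<bar>?X w w'\<bar> ^ q + D * \<bar>noise c n k v w w'\<bar> ^ q"
          by (rule D) auto
        finally have "ennreal (\<bar>diff c (Suc n) (combine n k v w w')\<bar> ^ q)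
            \<le> ennreal ((1 + \<delta>) * \<bar>?X w w'\<bar> ^ q + D * \<bar>noise c n k v w w'\<bar> ^ q)"
          by (rule ennreal_leI)
        also have "\<dots> = ennreal ((1 + \<delta>) * \<bar>?X w w'\<bar> ^ q) + ennreal (D * \<bar>noise c n k v w w'\<bar> ^ q)"
          using \<delta> D by (intro ennreal_plus) auto
        also have "\<dots> = ennreal (1 + \<delta>) * ennreal (\<bar>?X w w'\<bar> ^ q) + ennreal D * ennreal (\<bar>noise c n k v w w'\<bar> ^ q)"
          using \<delta> D by (subst (1 2) ennreal_mult') auto
        finally show "ennreal (\<bar>diff c (Suc n) (combine n k v w w')\<bar> ^ q)
          \<le> ennreal (1 + \<delta>) * ennreal (\<bar>?X w w'\<bar> ^ q) + ennreal D * ennreal (\<bar>noise c n k v w w'\<bar> ^ q)" .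
      qed
      also have "\<dots> = ennreal (1 + \<delta>) * (\<integral>\<^sup>+w. \<integral>\<^sup>+w'. ennreal (\<bar>?X w w'\<bar> ^ q) \<partial>coupling (n - k) \<partial>coupling k)
          + ennreal D * (\<integral>\<^sup>+w. \<integral>\<^sup>+w'. ennreal (\<bar>noise c n k v w w'\<bar> ^ q) \<partial>coupling (n - k) \<partial>coupling k)"
        by (subst nn_integral_add, measurable, subst nn_integral_cmult, measurable, subst nn_integral_cmult, measurable,
            subst nn_integral_add, measurable, subst nn_integral_cmult, measurable, subst nn_integral_cmult, measurable)
      also have "\<dots> \<le> ennreal (1 + \<delta>) * (ennreal \<theta> * (moment c q k + moment c q (n - k)) + ennreal (C * (real n + 2) powr s))
          + ennreal D * ennreal (3 ^ q * (2 * B + G ^ q) * (real n + 2) powr s)"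
        unfolding s_def using kn v assms by (intro add_mono mult_left_mono pair noise_moment) auto
      also have "\<dots> = ennreal ((1 + \<delta>) * \<theta>) * (moment c q k + moment c q (n - k))
          + (ennreal ((1 + \<delta>) * (C * (real n + 2) powr s)) + ennreal (D * (3 ^ q * (2 * B + G ^ q) * (real n + 2) powr s)))"
        using \<delta> D(1) by (simp add: ennreal_mult' distrib_left mult.assoc add.assoc)
      also have "ennreal ((1 + \<delta>) * (C * (real n + 2) powr s)) + ennreal (D * (3 ^ q * (2 * B + G ^ q) * (real n + 2) powr s))
          = ennreal (R * (real n + 2) powr s)"
        using \<delta> D(1) assms G by (subst ennreal_plus[symmetric]) (auto simp: R_def algebra_simps)
      finally show ?thesis .
    qed
    have "?I n k \<le> (\<integral>\<^sup>+v. ennreal ((1 + \<delta>) * \<theta>) * (moment c q k + moment c q (n - k)) + ennreal (R * (real n + 2) powr s) \<partial>unif01)"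
      by (rule nn_integral_mono_AE, use AE_unif01 in eventually_elim) (auto intro: inner)
    then show ?thesis using U.emeasure_space_1 by simp
  qed
  \<comment> \<open>At size 0 the error vanishes: the count and its mean are 0, and the limit
    variable has weight 0.\<close>
  have a0: "moment c q 0 \<le> ennreal R"
    using \<open>q > 0\<close> unfolding moment_def
    by (simp add: nn_integral_distr diff_def qs_mean_def harm_def zero_power)
  have aS: "moment c q (Suc n) = (\<Sum>k\<le>n. ?I n k) / ennreal (real n + 1)" for n
    unfolding moment_def by (rule nn_integral_coupling_Suc) measurable
  obtain K where "K \<ge> 0" "\<And>n. moment c q n \<le> ennreal (K * (real n + 1) powr s)"
    using divide_and_conquer_recursion[of s "(1 + \<delta>) * \<theta>" R "moment c q" ?I, OF _ _ \<theta>' R a0 aS I]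
      assms \<delta> unfolding s_def by auto
  then show thesis using that unfolding s_def by blast
qed

text \<open>For \<open>q = 2\<close> the factor 2 of the recursion is critical at \<open>\<alpha> = 1/2\<close>; this is where \<open>\<alpha> > 1/2\<close> and the
  centering of the errors are needed.\<close>

lemma moment_bound_base:
  assumes "B \<ge> 0" "(\<integral>\<^sup>+y. ennreal (\<bar>c * y\<bar> ^ 2) \<partial>M) \<le> ennreal B"
  obtains K where "K \<ge> 0" "\<And>n. moment c 2 n \<le> ennreal (K * (real n + 1) powr (\<alpha> * real 2))"
proof (rule moment_recursion[of 2 B 1 0])
  fix n k :: nat assume "k \<le> n"
  interpret A: prob_space "coupling k" by (rule prob_space_coupling)
  have "(\<integral>\<^sup>+w. \<integral>\<^sup>+w'. ennreal (\<bar>diff c k w + diff c (n - k) w'\<bar> ^ 2) \<partial>coupling (n - k) \<partial>coupling k)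
      = (\<integral>\<^sup>+w. ennreal (\<bar>diff c k w\<bar>\<^sup>2) + moment c 2 (n - k) \<partial>coupling k)"
    unfolding moment_def power2_abs
    by (intro nn_integral_cong nn_integral_centered_square prob_space_coupling diff_centered)
  also have "\<dots> = moment c 2 k + moment c 2 (n - k)"
    by (subst nn_integral_add) (auto simp: moment_def A.emeasure_space_1)
  finally show "(\<integral>\<^sup>+w. \<integral>\<^sup>+w'. ennreal (\<bar>diff c k w + diff c (n - k) w'\<bar> ^ 2) \<partial>coupling (n - k) \<partial>coupling k)
      \<le> ennreal 1 * (moment c 2 k + moment c 2 (n - k)) + ennreal (0 * (real n + 2) powr (\<alpha> * real 2))"
    by simp
qed (use assms \<alpha> that in auto)

text \<open>By independence the mixed term integrates to D times a product of two moments of order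
  p, which is of order n^(2 \<alpha> p) like the noise; the pure terms enter with factor
  5/4.\<close>

lemma moment_bound_double:
  assumes "p \<ge> 2" "B \<ge> 0" "(\<integral>\<^sup>+y. ennreal (\<bar>c * y\<bar> ^ (2 * p)) \<partial>M) \<le> ennreal B"
    and "K \<ge> 0" and K: "\<And>n. moment c p n \<le> ennreal (K * (real n + 1) powr (\<alpha> * real p))"
  obtains K' where "K' \<ge> 0" "\<And>n. moment c (2 * p) n \<le> ennreal (K' * (real n + 1) powr (\<alpha> * real (2 * p)))"
proof -
  \<comment> \<open>With \<theta> = 5/4 the recursion requires 5/2 < 2 \<alpha> p + 1, which holds
    once 2 \<alpha> p >= 2.\<close>
  have "(1/2) * 4 \<le> \<alpha> * real (2 * p)"
    using \<alpha> assms(1) by (intro mult_mono) auto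
  then have large: "2 \<le> \<alpha> * real (2 * p)" by simp
  obtain D :: real where D: "D \<ge> 0" "\<And>x y. \<lbrakk>0 \<le> x; 0 \<le> y\<rbrakk> \<Longrightarrow>
      (x + y) ^ (2 * p) \<le> (1 + 1/4) * (x ^ (2 * p) + y ^ (2 * p)) + D * (x ^ p * y ^ p)"
    using power_double_add_le_split[of "1/4" p] assms(1) by auto
  show thesis
  proof (rule moment_recursion[of "2 * p" B "1 + 1/4" "D * K\<^sup>2"])
    fix n k :: nat assume kn: "k \<le> n"
    interpret A: prob_space "coupling k" by (rule prob_space_coupling)
    interpret B: prob_space "coupling (n - k)" by (rule prob_space_coupling)
    let ?x = "\<lambda>j w. \<bar>diff c j w\<bar>"
    have "(\<integral>\<^sup>+w. \<integral>\<^sup>+w'. ennreal (\<bar>diff c k w + diff c (n - k) w'\<bar> ^ (2 * p)) \<partial>coupling (n - k) \<partial>coupling k)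
        \<le> (\<integral>\<^sup>+w. \<integral>\<^sup>+w'. ennreal (1 + 1/4) * (ennreal (?x k w ^ (2 * p)) + ennreal (?x (n - k) w' ^ (2 * p)))
            + ennreal D * (ennreal (?x k w ^ p) * ennreal (?x (n - k) w' ^ p)) \<partial>coupling (n - k) \<partial>coupling k)"
    proof (intro nn_integral_mono)
      fix w w'
      have "\<bar>diff c k w + diff c (n - k) w'\<bar> ^ (2 * p) \<le> (?x k w + ?x (n - k) w') ^ (2 * p)"
        by (intro power_mono abs_triangle_ineq) auto
      also have "\<dots> \<le> (1 + 1/4) * (?x k w ^ (2 * p) + ?x (n - k) w' ^ (2 * p)) + D * (?x k w ^ p * ?x (n - k) w' ^ p)"
        by (rule D) auto
      finally have "ennreal (\<bar>diff c k w + diff c (n - k) w'\<bar> ^ (2 * p))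
          \<le> ennreal ((1 + 1/4) * (?x k w ^ (2 * p) + ?x (n - k) w' ^ (2 * p)) + D * (?x k w ^ p * ?x (n - k) w' ^ p))"
        by (rule ennreal_leI)
      also have "\<dots> = ennreal ((1 + 1/4) * (?x k w ^ (2 * p) + ?x (n - k) w' ^ (2 * p))) + ennreal (D * (?x k w ^ p * ?x (n - k) w' ^ p))"
        using D(1) by (intro ennreal_plus) auto
      also have "ennreal ((1 + 1/4) * (?x k w ^ (2 * p) + ?x (n - k) w' ^ (2 * p)))
          = ennreal (1 + 1/4) * (ennreal (?x k w ^ (2 * p)) + ennreal (?x (n - k) w' ^ (2 * p)))"
        by (intro ennreal_mult_plus) auto
      also have "ennreal (D * (?x k w ^ p * ?x (n - k) w' ^ p)) = ennreal D * (ennreal (?x k w ^ p) * ennreal (?x (n - k) w' ^ p))"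
        using D(1) by (simp add: ennreal_mult')
      finally show "ennreal (\<bar>diff c k w + diff c (n - k) w'\<bar> ^ (2 * p))
          \<le> ennreal (1 + 1/4) * (ennreal (?x k w ^ (2 * p)) + ennreal (?x (n - k) w' ^ (2 * p)))
            + ennreal D * (ennreal (?x k w ^ p) * ennreal (?x (n - k) w' ^ p))" .
    qed
    also have "\<dots> = (\<integral>\<^sup>+w. ennreal (1 + 1/4) * (ennreal (?x k w ^ (2 * p)) + moment c (2 * p) (n - k))
            + ennreal D * (ennreal (?x k w ^ p) * moment c p (n - k)) \<partial>coupling k)"
    proof (rule nn_integral_cong)
      fix w
      show "(\<integral>\<^sup>+w'. ennreal (1 + 1/4) * (ennreal (?x k w ^ (2 * p)) + ennreal (?x (n - k) w' ^ (2 * p)))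
            + ennreal D * (ennreal (?x k w ^ p) * ennreal (?x (n - k) w' ^ p)) \<partial>coupling (n - k))
        = ennreal (1 + 1/4) * (ennreal (?x k w ^ (2 * p)) + moment c (2 * p) (n - k))
            + ennreal D * (ennreal (?x k w ^ p) * moment c p (n - k))"
        unfolding moment_def
        by (subst nn_integral_add, measurable, subst nn_integral_cmult, measurable, subst nn_integral_add, measurable,
            subst nn_integral_cmult, measurable, subst nn_integral_cmult, measurable)
           (simp add: B.emeasure_space_1)
    qed
    also have "\<dots> = ennreal (1 + 1/4) * (moment c (2 * p) k + moment c (2 * p) (n - k))
            + ennreal D * (moment c p k * moment c p (n - k))"
      unfolding moment_def[of c _ k]
      by (subst nn_integral_add, measurable, subst nn_integral_cmult, measurable, subst nn_integral_add, measurable,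
          subst nn_integral_cmult, measurable, subst nn_integral_multc, measurable)
         (simp add: A.emeasure_space_1)
    also have "ennreal D * (moment c p k * moment c p (n - k)) \<le> ennreal (D * K\<^sup>2 * (real n + 2) powr (\<alpha> * real (2 * p)))"
    proof -
      have b: "moment c p j \<le> ennreal (K * (real n + 2) powr (\<alpha> * real p))" if "j \<le> n" for j
        using that \<open>K \<ge> 0\<close> \<alpha> by (intro order.trans[OF K] ennreal_leI mult_left_mono powr_mono2) auto
      have "ennreal D * (moment c p k * moment c p (n - k))
          \<le> ennreal D * (ennreal (K * (real n + 2) powr (\<alpha> * real p)) * ennreal (K * (real n + 2) powr (\<alpha> * real p)))"
        using kn by (intro mult_left_mono mult_mono b) auto
      also have "\<dots> = ennreal (D * ((K * (real n + 2) powr (\<alpha> * real p)) * (K * (real n + 2) powr (\<alpha> * real p))))"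
        using D(1) \<open>K \<ge> 0\<close> by (simp add: ennreal_mult')
      also have "D * ((K * (real n + 2) powr (\<alpha> * real p)) * (K * (real n + 2) powr (\<alpha> * real p)))
          = D * K\<^sup>2 * ((real n + 2) powr (\<alpha> * real p) * (real n + 2) powr (\<alpha> * real p))"
        by (simp add: power2_eq_square)
      also have "(real n + 2) powr (\<alpha> * real p) * (real n + 2) powr (\<alpha> * real p) = (real n + 2) powr (\<alpha> * real (2 * p))"
        by (simp add: powr_add[symmetric] algebra_simps)
      finally show ?thesis .
    qed
    finally show "(\<integral>\<^sup>+w. \<integral>\<^sup>+w'. ennreal (\<bar>diff c k w + diff c (n - k) w'\<bar> ^ (2 * p)) \<partial>coupling (n - k) \<partial>coupling k)
        \<le> ennreal (1 + 1/4) * (moment c (2 * p) k + moment c (2 * p) (n - k))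
          + ennreal (D * K\<^sup>2 * (real n + 2) powr (\<alpha> * real (2 * p)))"
      by (simp add: add_left_mono)
  qed (use assms D(1) large that in auto)
qed

lemma moment_bound:
  assumes "\<And>r. \<exists>B\<ge>0. (\<integral>\<^sup>+y. ennreal (\<bar>c * y\<bar> ^ (2 ^ Suc r)) \<partial>M) \<le> ennreal B"
  shows "\<exists>K\<ge>0. \<forall>n. moment c (2 ^ Suc r) n \<le> ennreal (K * (real n + 1) powr (\<alpha> * real (2 ^ Suc r)))"
proof (induction r)
  case 0
  obtain B where "B \<ge> 0" "(\<integral>\<^sup>+y. ennreal (\<bar>c * y\<bar> ^ 2) \<partial>M) \<le> ennreal B"
    using assms[of 0] by auto
  then show ?case using moment_bound_base[of B] by (metis One_nat_def power_one_right)
next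
  case (Suc r)
  then obtain K where K: "K \<ge> 0" "\<And>n. moment c (2 ^ Suc r) n \<le> ennreal (K * (real n + 1) powr (\<alpha> * real (2 ^ Suc r)))"
    by blast
  obtain B where B: "B \<ge> 0" "(\<integral>\<^sup>+y. ennreal (\<bar>c * y\<bar> ^ (2 * 2 ^ Suc r)) \<partial>M) \<le> ennreal B"
    using assms[of "Suc r"] by auto
  have "(2::nat) \<le> 2 ^ Suc r" by simp
  then obtain K' where "K' \<ge> 0" "\<And>n. moment c (2 * 2 ^ Suc r) n \<le> ennreal (K' * (real n + 1) powr (\<alpha> * real (2 * 2 ^ Suc r)))"
    by (rule moment_bound_double[OF _ B K]) (rule that)
  then show ?case unfolding power_Suc[of 2 "Suc r"] by blast
qed

end

section \<open>Kolmogorov--Smirnov distance\<close>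

context quicksort_limit
begin

lemma comparison_centered: "quicksort_comparison M 0 1 30"
  by unfold_locales (use split_cost_linear in auto)

lemma comparison_limit: "\<eta> > 0 \<Longrightarrow> quicksort_comparison M 1 (1/2 + \<eta>) 25"
proof unfold_locales
  fix n k :: nat and v :: real
  assume "\<eta> > 0" "k \<le> n" "0 < v" "v < 1"
  then have "(real n + 2) powr (1/2) \<le> (real n + 2) powr (1/2 + \<eta>)"
    by (intro powr_mono) auto
  then show "\<bar>split_cost n k - 1 * ((real n + 1) * toll ((real k + v) / (real n + 1)))\<bar> \<le> 25 * (real n + 2) powr (1/2 + \<eta>)"
    using split_cost_approx[OF \<open>k \<le> n\<close> \<open>0 < v\<close> \<open>v < 1\<close>] unfolding mult_1 by linarith
qed auto

section \<open>Moments of the limit law\<close>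

lemma limit_second_moment: "\<exists>B\<ge>0. (\<integral>\<^sup>+y. ennreal (\<bar>y\<bar> ^ 2) \<partial>M) \<le> ennreal B"
proof (intro exI conjI)
  have "integrable M (\<lambda>y. \<bar>y\<bar> ^ 2)" using limit_law by (simp add: is_quicksort_limit_law_def)
  then show "(\<integral>\<^sup>+y. ennreal (\<bar>y\<bar> ^ 2) \<partial>M) \<le> ennreal (\<integral>y. \<bar>y\<bar> ^ 2 \<partial>M)"
    by (subst nn_integral_eq_integral) auto
qed simp

text \<open>Only the second moment of M is given. Higher ones come from Y = \<open>diff 0 n\<close>
  / n - \<open>diff 1 n\<close> / n: the q-th moment of the first term is bounded in n, since weight
  0 asks nothing of M, while the second term is truncated at L and controlled in mean square. The
  resulting B is free of L, and monotone convergence removes the truncation.\<close>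

lemma limit_moment: "\<exists>B\<ge>0. (\<integral>\<^sup>+y. ennreal (\<bar>y\<bar> ^ (2 ^ Suc r)) \<partial>M) \<le> ennreal B"
proof -
  define q :: nat where "q = 2 ^ Suc r"
  have q: "q \<ge> 2" by (simp add: q_def)
  interpret Z: quicksort_comparison M 0 1 30 by (rule comparison_centered)
  \<comment> \<open>Here 2 \<alpha> = 3/2, so the second moment of the error is of order n^(3/2) and
    vanishes against n^2; any \<alpha> strictly between 1/2 and 1 would give such decay.\<close>
  interpret D: quicksort_comparison M 1 "1/2 + 1/4" 25 by (rule comparison_limit) simp
  obtain K where K: "K \<ge> 0" "\<And>n. moment 0 q n \<le> ennreal (K * (real n + 1) powr (1 * real q))"
    using Z.moment_bound[of r] unfolding q_def by (auto simp: zero_power)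
  obtain K2 where K2: "K2 \<ge> 0" "\<And>n. moment 1 2 n \<le> ennreal (K2 * (real n + 1) powr ((1/2 + 1/4) * real 2))"
    using limit_second_moment D.moment_bound_base by auto
  define B where "B = 3 ^ q * (K * 2 ^ q + 1)"
  have trunc: "(\<integral>\<^sup>+y. ennreal (min \<bar>y\<bar> (real L) ^ q) \<partial>M) \<le> ennreal B" if L: "L \<ge> 1" for L :: nat
  proof -
    \<comment> \<open>The quadratic bound on the coupling error beats \<open>L\<^sup>q\<close> once \<open>n\<close> is large enough.\<close>
    have "((\<lambda>n. real L ^ q * K2 * ((real n + 1) powr (3/2) / (real n)\<^sup>2)) \<longlongrightarrow> real L ^ q * K2 * 0) sequentially"
      by (intro tendsto_mult tendsto_const) real_asymp
    then have "eventually (\<lambda>n. real L ^ q * K2 * ((real n + 1) powr (3/2) / (real n)\<^sup>2) < 1) sequentially"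
      by (intro order_tendstoD(2)) auto
    then have "eventually (\<lambda>n. n \<ge> 1 \<and> real L ^ q * K2 * ((real n + 1) powr (3/2) / (real n)\<^sup>2) < 1) sequentially"
      using eventually_ge_at_top[of 1] by eventually_elim auto
    then obtain n where n: "n \<ge> 1" "real L ^ q * K2 * ((real n + 1) powr (3/2) / (real n)\<^sup>2) < 1"
      by (auto simp: eventually_sequentially)
    interpret C: prob_space "coupling n" by (rule prob_space_coupling)
    let ?a = "3 ^ q / real n ^ q" and ?b = "3 ^ q * real L ^ q / (real n)\<^sup>2"
    have pointwise: "min \<bar>snd w\<bar> (real L) ^ q \<le> ?a * \<bar>diff 0 n w\<bar> ^ q + ?b * \<bar>diff 1 n w\<bar> ^ 2" for w
    proof -
      let ?d = "min (\<bar>diff 1 n w\<bar> / real n) (real L)"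
      have "snd w = diff 0 n w / real n - diff 1 n w / real n"
        using n(1) by (simp add: diff_def field_simps)
      then have "\<bar>snd w\<bar> \<le> \<bar>diff 0 n w\<bar> / real n + \<bar>diff 1 n w\<bar> / real n"
        by (metis abs_divide abs_of_nat abs_triangle_ineq4)
      moreover have "0 \<le> \<bar>diff 0 n w\<bar> / real n" by simp
      \<comment> \<open>Only the second term is truncated, as min (a + b) L <= a + min b L for a >=
        0. The summand 0 gives the three-term shape of \<open>power_add3_le\<close>.\<close>
      ultimately have "min \<bar>snd w\<bar> (real L) \<le> \<bar>diff 0 n w\<bar> / real n + ?d + 0"
        by linarith
      then have "min \<bar>snd w\<bar> (real L) ^ q \<le> (\<bar>diff 0 n w\<bar> / real n + ?d + 0) ^ q"
        by (intro power_mono) auto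
      also have "\<dots> \<le> 3 ^ q * ((\<bar>diff 0 n w\<bar> / real n) ^ q + ?d ^ q + 0 ^ q)"
        by (intro power_add3_le) auto
      \<comment> \<open>Two of the q factors keep the error in mean square, the other q - 2 are
        bounded by L, and L >= 1 allows L^q.\<close>
      also have "?d ^ q = ?d ^ 2 * ?d ^ (q - 2)"
        using q by (simp only: power_add[symmetric] le_add_diff_inverse)
      also have "\<dots> \<le> (\<bar>diff 1 n w\<bar> / real n) ^ 2 * real L ^ q"
      proof (intro mult_mono power_mono)
        have "?d ^ (q - 2) \<le> real L ^ (q - 2)" by (intro power_mono) auto
        also have "\<dots> \<le> real L ^ q" using L by (intro power_increasing) auto
        finally show "?d ^ (q - 2) \<le> real L ^ q" .
      qed auto
      finally have "min \<bar>snd w\<bar> (real L) ^ q \<le> 3 ^ q * ((\<bar>diff 0 n w\<bar> / real n) ^ q + (\<bar>diff 1 n w\<bar> / real n) ^ 2 * real L ^ q + 0 ^ q)"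
        by simp
      then show ?thesis using q by (simp add: power_divide algebra_simps zero_power)
    qed
    have "(\<integral>\<^sup>+y. ennreal (min \<bar>y\<bar> (real L) ^ q) \<partial>M) = (\<integral>\<^sup>+w. ennreal (min \<bar>snd w\<bar> (real L) ^ q) \<partial>coupling n)"
      by (rule nn_integral_coupling_snd[symmetric]) measurable
    also have "\<dots> \<le> (\<integral>\<^sup>+w. ennreal ?a * ennreal (\<bar>diff 0 n w\<bar> ^ q) + ennreal ?b * ennreal (\<bar>diff 1 n w\<bar> ^ 2) \<partial>coupling n)"
    proof (rule nn_integral_mono)
      fix w
      have "ennreal (min \<bar>snd w\<bar> (real L) ^ q) \<le> ennreal (?a * \<bar>diff 0 n w\<bar> ^ q + ?b * \<bar>diff 1 n w\<bar> ^ 2)"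
        by (rule ennreal_leI[OF pointwise])
      also have "\<dots> = ennreal (?a * \<bar>diff 0 n w\<bar> ^ q) + ennreal (?b * \<bar>diff 1 n w\<bar> ^ 2)"
        by (rule ennreal_plus) auto
      also have "ennreal (?a * \<bar>diff 0 n w\<bar> ^ q) = ennreal ?a * ennreal (\<bar>diff 0 n w\<bar> ^ q)"
        by (rule ennreal_mult') simp
      also have "ennreal (?b * \<bar>diff 1 n w\<bar> ^ 2) = ennreal ?b * ennreal (\<bar>diff 1 n w\<bar> ^ 2)"
        by (rule ennreal_mult') simp
      finally show "ennreal (min \<bar>snd w\<bar> (real L) ^ q) \<le> ennreal ?a * ennreal (\<bar>diff 0 n w\<bar> ^ q) + ennreal ?b * ennreal (\<bar>diff 1 n w\<bar> ^ 2)" .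
    qed
    also have "\<dots> = ennreal ?a * moment 0 q n + ennreal ?b * moment 1 2 n"
      unfolding moment_def
      by (subst nn_integral_add, measurable, subst nn_integral_cmult, measurable, subst nn_integral_cmult, measurable)
    also have "\<dots> \<le> ennreal ?a * ennreal (K * (real n + 1) powr (1 * real q)) + ennreal ?b * ennreal (K2 * (real n + 1) powr ((1/2 + 1/4) * real 2))"
      by (intro add_mono mult_left_mono K K2) auto
    also have "\<dots> = ennreal (?a * (K * (real n + 1) powr (1 * real q))) + ennreal (?b * (K2 * (real n + 1) powr ((1/2 + 1/4) * real 2)))"
      by (subst (1 2) ennreal_mult') auto
    also have "\<dots> = ennreal (?a * (K * (real n + 1) powr (1 * real q)) + ?b * (K2 * (real n + 1) powr ((1/2 + 1/4) * real 2)))"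
      using K(1) K2(1) by (intro ennreal_plus[symmetric] mult_nonneg_nonneg) auto
    also have "\<dots> \<le> ennreal B"
    proof (rule ennreal_leI)
      have "(real n + 1) powr (1 * real q) = (real n + 1) ^ q" by (simp add: powr_realpow)
      also have "\<dots> \<le> (2 * real n) ^ q" using n by (intro power_mono) auto
      finally have "?a * (K * (real n + 1) powr (1 * real q)) \<le> ?a * (K * (2 * real n) ^ q)"
        using K(1) by (intro mult_left_mono) auto
      also have "\<dots> = 3 ^ q * (K * 2 ^ q)" using n by (simp add: power_mult_distrib)
      finally have 1: "?a * (K * (real n + 1) powr (1 * real q)) \<le> 3 ^ q * (K * 2 ^ q)" .
      have "?b * (K2 * (real n + 1) powr ((1/2 + 1/4) * real 2)) = 3 ^ q * (real L ^ q * K2 * ((real n + 1) powr (3/2) / (real n)\<^sup>2))"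
        by simp
      also have "\<dots> \<le> 3 ^ q * 1" using n(2) by (intro mult_left_mono) auto
      finally show "?a * (K * (real n + 1) powr (1 * real q)) + ?b * (K2 * (real n + 1) powr ((1/2 + 1/4) * real 2)) \<le> B"
        using 1 by (simp add: B_def distrib_left)
    qed
    finally show ?thesis .
  qed
  let ?f = "\<lambda>L y. ennreal (min \<bar>y\<bar> (real (Suc L)) ^ q)"
  have "(\<integral>\<^sup>+y. ennreal (\<bar>y\<bar> ^ q) \<partial>M) \<le> (\<integral>\<^sup>+y. (SUP L. ?f L y) \<partial>M)"
  proof (intro nn_integral_mono)
    fix y :: real
    have "ennreal (\<bar>y\<bar> ^ q) = ?f (nat \<lceil>\<bar>y\<bar>\<rceil>) y"
      by (auto simp: min_def not_le) linarith
    also have "\<dots> \<le> (SUP L. ?f L y)" by (rule SUP_upper) simp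
    finally show "ennreal (\<bar>y\<bar> ^ q) \<le> (SUP L. ?f L y)" .
  qed
  also have "\<dots> = (SUP L. \<integral>\<^sup>+y. ?f L y \<partial>M)"
    by (rule nn_integral_monotone_convergence_SUP)
       (auto simp: incseq_def le_fun_def intro!: ennreal_leI power_mono min.mono)
  also have "\<dots> \<le> ennreal B" by (rule SUP_least, rule trunc) simp
  finally have "(\<integral>\<^sup>+y. ennreal (\<bar>y\<bar> ^ q) \<partial>M) \<le> ennreal B" .
  moreover have "B \<ge> 0" using K(1) by (simp add: B_def)
  ultimately show ?thesis unfolding q_def by blast
qed

section \<open>From the coupling to distribution functions\<close>

lemma measure_Yn_law:
  "measure (Yn_law n) {..x} = measure (coupling n) {w \<in> space (coupling n). (fst w - qs_mean n) / real n \<le> x}"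
proof -
  let ?A = "{a. (a - qs_mean n) / real n \<le> x}"
  have [measurable]: "?A \<in> sets borel" by measurable
  have "measure (coupling n) {w \<in> space (coupling n). (fst w - qs_mean n) / real n \<le> x} = measure (distr (coupling n) borel fst) ?A"
    by (subst measure_distr) (auto intro!: arg_cong2[where f=measure])
  also have "\<dots> = measure (measure_pmf (qs_comparisons n)) (real -` ?A)"
    unfolding distr_coupling_fst by (subst measure_distr) auto
  finally show ?thesis
    unfolding Yn_law_def by (simp add: vimage_def)
qed

lemma measure_limit:
  assumes [measurable]: "A \<in> sets borel"
  shows "measure M A = measure (coupling n) {w \<in> space (coupling n). snd w \<in> A}"
proof -
  have "measure M A = measure (distr (coupling n) borel snd) A" unfolding distr_coupling_snd ..
  also have "\<dots> = measure (coupling n) {w \<in> space (coupling n). snd w \<in> A}"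
    by (subst measure_distr) (auto intro!: arg_cong2[where f=measure])
  finally show ?thesis .
qed

text \<open>The events Y_n <= x and Y <= x can differ only if Y lies within h of x or the coupling
  error |Y_n - Y| is at least h.\<close>

lemma cdf_difference_le:
  assumes "n \<ge> 1" "h > 0"
  shows "\<bar>measure (Yn_law n) {..x} - measure M {..x}\<bar>
    \<le> measure M {x - h..x + h} + measure (coupling n) {w \<in> space (coupling n). real n * h \<le> \<bar>diff 1 n w\<bar>}"
proof -
  interpret C: prob_space "coupling n" by (rule prob_space_coupling)
  let ?S = "\<lambda>P. {w \<in> space (coupling n). P w}"
  let ?X = "\<lambda>w. (fst w - qs_mean n) / real n \<le> x" and ?E = "\<lambda>w. real n * h \<le> \<bar>diff 1 n w\<bar>"
  have close: "\<bar>(fst w - qs_mean n) / real n - snd w\<bar> < h" if "\<not> ?E w" for w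
  proof -
    have "(fst w - qs_mean n) / real n - snd w = diff 1 n w / real n"
      using assms by (simp add: diff_def field_simps)
    then show ?thesis using that assms by (simp add: abs_divide pos_divide_less_eq mult.commute)
  qed
  have M: "measure M {..y} = measure (coupling n) (?S (\<lambda>w. snd w \<le> y))" for y
    using measure_limit[of "{..y}" n] by simp
  have I: "measure M {x - h..x + h} = measure (coupling n) (?S (\<lambda>w. x - h \<le> snd w \<and> snd w \<le> x + h))"
    using measure_limit[of "{x - h..x + h}" n] by simp
  have union: "measure (coupling n) (?S P) \<le> measure (coupling n) (?S Q) + measure (coupling n) (?S R) + measure (coupling n) (?S ?E)"
    if [measurable]: "?S P \<in> sets (coupling n)" "?S Q \<in> sets (coupling n)" "?S R \<in> sets (coupling n)"
      and sub: "\<And>w. P w \<Longrightarrow> Q w \<or> R w \<or> ?E w" for P Q R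
  proof -
    have E: "?S ?E \<in> sets (coupling n)" by measurable
    have "measure (coupling n) (?S P) \<le> measure (coupling n) ((?S Q \<union> ?S R) \<union> ?S ?E)"
      using sub that E by (intro C.finite_measure_mono) auto
    also have "\<dots> \<le> measure (coupling n) (?S Q \<union> ?S R) + measure (coupling n) (?S ?E)"
      using that E by (intro measure_Un_le) auto
    also have "\<dots> \<le> measure (coupling n) (?S Q) + measure (coupling n) (?S R) + measure (coupling n) (?S ?E)"
      using that by (intro add_right_mono measure_Un_le) auto
    finally show ?thesis .
  qed
  have "measure (coupling n) (?S ?X) \<le> measure (coupling n) (?S (\<lambda>w. snd w \<le> x))
      + measure (coupling n) (?S (\<lambda>w. x - h \<le> snd w \<and> snd w \<le> x + h)) + measure (coupling n) (?S ?E)"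
  proof (rule union)
    fix w :: "real \<times> real" assume "?X w"
    then show "snd w \<le> x \<or> (x - h \<le> snd w \<and> snd w \<le> x + h) \<or> ?E w"
      using close[of w] \<open>h > 0\<close> by (cases "?E w") auto
  qed measurable
  moreover have "measure (coupling n) (?S (\<lambda>w. snd w \<le> x)) \<le> measure (coupling n) (?S ?X)
      + measure (coupling n) (?S (\<lambda>w. x - h \<le> snd w \<and> snd w \<le> x + h)) + measure (coupling n) (?S ?E)"
  proof (rule union)
    fix w :: "real \<times> real" assume "snd w \<le> x"
    then show "?X w \<or> (x - h \<le> snd w \<and> snd w \<le> x + h) \<or> ?E w"
      using close[of w] \<open>h > 0\<close> by (cases "?E w") auto
  qed measurable
  ultimately show ?thesis unfolding measure_Yn_law M I by linarith
qed

text \<open>Markov's inequality for the q-th power.\<close>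

lemma diff_tail:
  assumes "t > 0" "K \<ge> 0" "moment c q n \<le> ennreal K"
  shows "measure (coupling n) {w \<in> space (coupling n). t \<le> \<bar>diff c n w\<bar>} \<le> K / t ^ q"
proof -
  interpret C: prob_space "coupling n" by (rule prob_space_coupling)
  let ?E = "{w \<in> space (coupling n). t \<le> \<bar>diff c n w\<bar>}"
  have [measurable]: "?E \<in> sets (coupling n)" by measurable
  have "ennreal (t ^ q * measure (coupling n) ?E) = ennreal (t ^ q) * emeasure (coupling n) ?E"
    using assms by (subst ennreal_mult') (auto simp: C.emeasure_eq_measure)
  also have "\<dots> = (\<integral>\<^sup>+w. ennreal (t ^ q) * indicator ?E w \<partial>coupling n)"
    by (rule nn_integral_cmult_indicator[symmetric]) measurable
  also have "\<dots> \<le> moment c q n"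
    unfolding moment_def using assms(1)
    by (intro nn_integral_mono) (auto split: split_indicator intro!: ennreal_leI power_mono)
  also have "\<dots> \<le> ennreal K" by fact
  finally show ?thesis using assms by (simp add: field_simps)
qed

end

theorem theorem5p2:
  fixes M :: "real measure" and \<epsilon> :: real
  assumes "is_quicksort_limit_law M"
    and "\<epsilon> > 0"
  shows "(\<lambda>n. d_KS (Yn_law n) M) \<in> O(\<lambda>n. real n powr (\<epsilon> - 1/2))"
proof -
  interpret quicksort_limit M by unfold_locales fact
  \<comment> \<open>The concentration estimate needs an exponent below 1; replacing \<epsilon> by a
    smaller e only strengthens the bound.\<close>
  define e where "e = min \<epsilon> (1/2)"
  have e: "0 < e" "e < 1" "e \<le> \<epsilon>" using assms by (auto simp: e_def)
  \<comment> \<open>With h = n^(2 \<eta> - 1/2) the concentration bound has exponent (2 \<eta> -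
    1/2) (1 - e) = 3 e/4 - 1/2 - e^2/4, which stays below e - 1/2.\<close>
  define \<eta> where "\<eta> = e / 8"
  have \<eta>: "\<eta> > 0" using e by (simp add: \<eta>_def)
  interpret D: quicksort_comparison M 1 "1/2 + \<eta>" 25 by (rule comparison_limit[OF \<eta>])
  \<comment> \<open>Then q >= r >= 1/(2 \<eta>), which makes n^(-\<eta> q) at most n^(-1/2).\<close>
  define r where "r = nat \<lceil>1 / (2 * \<eta>)\<rceil>"
  define q :: nat where "q = 2 ^ Suc r"
  have "1 / (2 * \<eta>) \<le> real r" unfolding r_def by linarith
  also have "real r \<le> real q"
    using less_exp[of "Suc r"] unfolding q_def by (simp only: of_nat_le_iff)
  finally have \<eta>q: "1/2 \<le> \<eta> * real q" using \<eta> by (simp add: field_simps)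
  obtain K where K: "K \<ge> 0" "\<And>n. moment 1 q n \<le> ennreal (K * (real n + 1) powr ((1/2 + \<eta>) * real q))"
    using D.moment_bound[of r] limit_moment unfolding q_def by auto
  define C where "C = 64 / e\<^sup>2 + K * 2 powr ((1/2 + \<eta>) * real q)"
  have bound: "\<bar>measure (Yn_law n) {..x} - measure M {..x}\<bar> \<le> C * real n powr (\<epsilon> - 1/2)" if n: "n \<ge> 1" for n x
  proof -
    have n1: "1 \<le> real n" using n by simp
    \<comment> \<open>At this scale n h = n^(1/2 + 2 \<eta>) exceeds the order n^(1/2 + \<eta>) of
      the coupling error by n^\<eta>, so Markov's inequality of order q gains the factor n^(-\<eta>
      q).\<close>
    define h where "h = real n powr (2 * \<eta> - 1/2)"
    have h: "h > 0" using n by (simp add: h_def)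
    have h_le: "h powr (1 - e) \<le> real n powr (\<epsilon> - 1/2)"
    proof -
      have "(2 * \<eta> - 1/2) * (1 - e) = e * 3 / 4 - 1/2 - e\<^sup>2 / 4"
        by (simp add: \<eta>_def power2_eq_square field_simps)
      also have "\<dots> \<le> \<epsilon> - 1/2" using e zero_le_power2[of e] by linarith
      finally show ?thesis unfolding h_def powr_powr using n1 by (intro powr_mono) auto
    qed
    have "measure M {x - h..x + h} \<le> 64 / e\<^sup>2 * h powr (1 - e)"
      using e h by (intro concentration)
    also have "\<dots> \<le> 64 / e\<^sup>2 * real n powr (\<epsilon> - 1/2)"
      by (intro mult_left_mono h_le) simp
    finally have 1: "measure M {x - h..x + h} \<le> 64 / e\<^sup>2 * real n powr (\<epsilon> - 1/2)" .
    have nh: "real n * h = real n powr (1/2 + 2 * \<eta>)"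
      using n1 by (simp add: h_def powr_mult_base)
    have "measure (coupling n) {w \<in> space (coupling n). real n * h \<le> \<bar>diff 1 n w\<bar>}
        \<le> K * (real n + 1) powr ((1/2 + \<eta>) * real q) / (real n * h) ^ q"
      using n h K by (intro diff_tail) auto
    also have "(real n * h) ^ q = real n powr ((1/2 + 2 * \<eta>) * real q)"
      unfolding nh using n1 by (simp add: powr_powr[symmetric] powr_realpow)
    also have "K * (real n + 1) powr ((1/2 + \<eta>) * real q) / real n powr ((1/2 + 2 * \<eta>) * real q)
        \<le> K * (2 * real n) powr ((1/2 + \<eta>) * real q) / real n powr ((1/2 + 2 * \<eta>) * real q)"
      using n1 K(1) \<eta> by (intro divide_right_mono mult_left_mono powr_mono2) auto
    also have "\<dots> = K * 2 powr ((1/2 + \<eta>) * real q) * real n powr ((1/2 + \<eta>) * real q - (1/2 + 2 * \<eta>) * real q)"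
      using n1 by (simp add: powr_mult powr_diff)
    also have "\<dots> \<le> K * 2 powr ((1/2 + \<eta>) * real q) * real n powr (\<epsilon> - 1/2)"
      using n1 \<eta>q assms(2) K(1) by (intro mult_left_mono powr_mono) (auto simp: algebra_simps)
    finally have 2: "measure (coupling n) {w \<in> space (coupling n). real n * h \<le> \<bar>diff 1 n w\<bar>}
        \<le> K * 2 powr ((1/2 + \<eta>) * real q) * real n powr (\<epsilon> - 1/2)" .
    from cdf_difference_le[OF n h, of x] 1 2 show ?thesis
      unfolding C_def distrib_right by linarith
  qed
  show ?thesis
  proof (rule bigoI)
    show "eventually (\<lambda>n. norm (d_KS (Yn_law n) M) \<le> C * norm (real n powr (\<epsilon> - 1/2))) sequentially"
      using eventually_ge_at_top[of 1]
    proof eventually_elim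
      case (elim n)
      let ?d = "\<lambda>x. \<bar>measure (Yn_law n) {..x} - measure M {..x}\<bar>"
      \<comment> \<open>A supremum of reals can be compared with its members only for a bounded
        family; \<open>bound\<close> supplies this.\<close>
      have bdd: "bdd_above (range ?d)" using bound[OF elim] by (intro bdd_aboveI) auto
      have "0 \<le> ?d 0" by simp
      also have "\<dots> \<le> d_KS (Yn_law n) M" unfolding d_KS_def by (rule cSUP_upper[OF _ bdd]) simp
      finally have "0 \<le> d_KS (Yn_law n) M" .
      moreover have "d_KS (Yn_law n) M \<le> C * real n powr (\<epsilon> - 1/2)"
        unfolding d_KS_def by (intro cSUP_least bound elim) auto
      ultimately show ?case by simp
    qed
  qed
qed

end
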